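(* Let $d\ge 2$ and consider the body-centered hypercubic lattice $\mathbb{B}^d$, in which each odd vertex is closed with probability $p$ and each even vertex is closed with probability $q$, independently for different vertices. Consider the game Trap between Eve and Odin on the open subgraph of $\mathbb{B}^d$. (i) Let $p>0$ and $q=0$. Then almost surely, for every initial vertex, Eve wins. (ii) For all $p>0$ there exists $q(p,d)>0$ such that if $q<q(p,d)$ then almost surely, for every initial vertex, the game is not a draw.
   Context: The lattice: $\mathbb{B}^d$ is the graph whose vertices are all elements of $\mathbb{Z}^d$ whose coordinates are all even (even vertices) or all odd (odd vertices), with an edge between $u$ and $v$ whenever $\|u-v\|_\infty=1$ and $u,v$ are of opposite type (so it is bipartite; each vertex has $2^d$ neighbors). Trap: a token starts at an initial vertex of a graph; two players alternately move it along an incident edge to a vertex never visited before (the initial vertex counts as visited). A player who has no possible move loses and the other wins. A strategy for a player assigns a legal next move (where one exists) to each position (location of token together with the set of visited vertices); a strategy is winning if it results in a win for that player whatever strategy the opponent uses. A player "wins" from an initial vertex if she/he has a winning strategy; the game is a draw if neither player has a winning strategy. Vertices that are not closed are open; Trap on the open subgraph means moves to closed vertices are forbidden. By convention the game is a first-player win if the initial vertex is closed. The closed/open configuration is known to both players. Odin is the player who moves from even vertices to odd vertices; Eve is the player who moves from odd vertices to even vertices. Thus if the initial vertex is even Odin moves first, and if it is odd Eve moves first. *)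

theory Defs
  imports "HOL-Probability.Probability"
begin

text \<open>
  Trap on a graph given by its adjacency relation. A position is the location of the token together
  with the set of visited vertices (which includes the location). Whose turn it is does not have to
  be recorded: in every play it is determined by the number of visited vertices.
\<close>

type_synonym 'v position = "'v \<times> 'v set"

type_synonym 'v strategy = "'v position \<Rightarrow> 'v"

definition trap_moves :: "('v \<Rightarrow> 'v \<Rightarrow> bool) \<Rightarrow> 'v position \<Rightarrow> 'v set" where
  "trap_moves adj pos = {y. adj (fst pos) y \<and> y \<notin> snd pos}"

definition trap_strategy :: "('v \<Rightarrow> 'v \<Rightarrow> bool) \<Rightarrow> 'v strategy \<Rightarrow> bool" where
  "trap_strategy adj \<sigma> \<longleftrightarrow> (\<forall>pos. trap_moves adj pos \<noteq> {} \<longrightarrow> \<sigma> pos \<in> trap_moves adj pos)"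

text \<open>
  The position after \<open>n\<close> moves when the first player uses \<open>\<sigma>\<close> and the second player uses \<open>\<tau>\<close>.
  It is meaningful only until some player has no possible move; \<open>trap_ends_at\<close> looks at no later
  position.
\<close>

fun trap_play :: "'v strategy \<Rightarrow> 'v strategy \<Rightarrow> 'v \<Rightarrow> nat \<Rightarrow> 'v position" where
  "trap_play \<sigma> \<tau> x 0 = (x, {x})"
| "trap_play \<sigma> \<tau> x (Suc n) =
    (let pos = trap_play \<sigma> \<tau> x n; y = (if even n then \<sigma> pos else \<tau> pos)
     in (y, insert y (snd pos)))"

definition trap_ends_at ::
    "('v \<Rightarrow> 'v \<Rightarrow> bool) \<Rightarrow> 'v strategy \<Rightarrow> 'v strategy \<Rightarrow> 'v \<Rightarrow> nat \<Rightarrow> bool" where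
  "trap_ends_at adj \<sigma> \<tau> x n \<longleftrightarrow>
    trap_moves adj (trap_play \<sigma> \<tau> x n) = {} \<and>
    (\<forall>m<n. trap_moves adj (trap_play \<sigma> \<tau> x m) \<noteq> {})"

text \<open>
  After an even number of moves the first player is to move, so the first player loses exactly the
  plays that end after an even number of moves. Plays that never end are won by nobody.
\<close>

definition trap_first_wins :: "('v \<Rightarrow> 'v \<Rightarrow> bool) \<Rightarrow> 'v \<Rightarrow> bool" where
  "trap_first_wins adj x \<longleftrightarrow>
    (\<exists>\<sigma>. trap_strategy adj \<sigma> \<and>
      (\<forall>\<tau>. trap_strategy adj \<tau> \<longrightarrow> (\<exists>n. odd n \<and> trap_ends_at adj \<sigma> \<tau> x n)))"

definition trap_second_wins :: "('v \<Rightarrow> 'v \<Rightarrow> bool) \<Rightarrow> 'v \<Rightarrow> bool" where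
  "trap_second_wins adj x \<longleftrightarrow>
    (\<exists>\<tau>. trap_strategy adj \<tau> \<and>
      (\<forall>\<sigma>. trap_strategy adj \<sigma> \<longrightarrow> (\<exists>n. even n \<and> trap_ends_at adj \<sigma> \<tau> x n)))"

text \<open>
  Trap on the subgraph induced by the vertices outside the closed set \<open>C\<close>. By convention the first
  player wins from a closed initial vertex.
\<close>

definition open_adj :: "('v \<Rightarrow> 'v \<Rightarrow> bool) \<Rightarrow> 'v set \<Rightarrow> 'v \<Rightarrow> 'v \<Rightarrow> bool" where
  "open_adj adj C u v \<longleftrightarrow> adj u v \<and> u \<notin> C \<and> v \<notin> C"

definition open_trap_first_wins :: "('v \<Rightarrow> 'v \<Rightarrow> bool) \<Rightarrow> 'v set \<Rightarrow> 'v \<Rightarrow> bool" where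
  "open_trap_first_wins adj C x \<longleftrightarrow> x \<in> C \<or> trap_first_wins (open_adj adj C) x"

definition open_trap_second_wins :: "('v \<Rightarrow> 'v \<Rightarrow> bool) \<Rightarrow> 'v set \<Rightarrow> 'v \<Rightarrow> bool" where
  "open_trap_second_wins adj C x \<longleftrightarrow> x \<notin> C \<and> trap_second_wins (open_adj adj C) x"

text \<open>The body-centered hypercubic lattice of dimension \<open>d = CARD('d)\<close>.\<close>

definition even_vertex :: "int ^ 'd \<Rightarrow> bool" where
  "even_vertex v \<longleftrightarrow> (\<forall>i. even (v $ i))"

definition odd_vertex :: "int ^ 'd \<Rightarrow> bool" where
  "odd_vertex v \<longleftrightarrow> (\<forall>i. odd (v $ i))"

definition bcc_vertices :: "(int ^ 'd) set" where
  "bcc_vertices = {v. even_vertex v \<or> odd_vertex v}"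

definition bcc_adj :: "int ^ 'd \<Rightarrow> int ^ 'd \<Rightarrow> bool" where
  "bcc_adj u v \<longleftrightarrow>
    (even_vertex u \<and> odd_vertex v \<or> odd_vertex u \<and> even_vertex v) \<and>
    Max (range (\<lambda>i. \<bar>u $ i - v $ i\<bar>)) = 1"

datatype player = Odin | Eve

definition first_mover :: "int ^ 'd \<Rightarrow> player" where
  "first_mover x = (if even_vertex x then Odin else Eve)"

definition bcc_wins :: "(int ^ 'd) set \<Rightarrow> player \<Rightarrow> int ^ 'd \<Rightarrow> bool" where
  "bcc_wins C P x \<longleftrightarrow>
    (if P = first_mover x then open_trap_first_wins bcc_adj C x
     else open_trap_second_wins bcc_adj C x)"

definition bcc_draw :: "(int ^ 'd) set \<Rightarrow> int ^ 'd \<Rightarrow> bool" where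
  "bcc_draw C x \<longleftrightarrow> \<not> bcc_wins C Odin x \<and> \<not> bcc_wins C Eve x"

text \<open>
  Random configurations: \<open>\<omega> v\<close> says that \<open>v\<close> is closed. Odd vertices are closed with
  probability \<open>p\<close>, even vertices with probability \<open>q\<close>.
\<close>

definition bcc_config :: "real \<Rightarrow> real \<Rightarrow> (int ^ 'd \<Rightarrow> bool) measure" where
  "bcc_config p q =
    (\<Pi>\<^sub>M v\<in>bcc_vertices. measure_pmf (bernoulli_pmf (if odd_vertex v then p else q)))"

definition closed_vertices :: "(int ^ 'd \<Rightarrow> bool) \<Rightarrow> (int ^ 'd) set" where
  "closed_vertices \<omega> = {v \<in> bcc_vertices. \<omega> v}"

end

theory Submission
  imports Defs "HOL-Real_Asymp.Real_Asymp"
begin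

text \<open>
  Write \<open>N(F)\<close> for the set of open neighbours of a set \<open>F\<close> of open vertices. Trap is decided by
  matchings: a player who can match \<open>N(F)\<close> into a finite set \<open>F\<close> of her own target vertices, avoiding
  the initial vertex if that belongs to \<open>F\<close>, wins by always moving along the matching. So fix an even
  vertex, take a large box around it, and let \<open>A\<close> be a set of open even vertices of the box that
  maximizes the deficiency \<open>|A| - |N(A)|\<close>, of least cardinality among these. By Hall's theorem
  \<open>N(A)\<close> can be matched into \<open>A\<close> without any given vertex of \<open>A\<close>, so Eve wins from \<open>A\<close> and from
  \<open>N(A)\<close>. A set \<open>F\<close> of open even vertices outside \<open>A\<close> satisfies \<open>|F| \<le> |N(F) - N(A)|\<close>, because it
  would otherwise improve \<open>A\<close>; hence such vertices can be matched into their outer neighbourhood, and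
  Odin answers along that matching as long as the token stays away from the boundary of the box.
  Consequently there is no draw from a vertex whose cluster of even vertices outside \<open>A\<close> does not
  reach the boundary (\<open>closed_region.first_wins_in_K\<close>, \<open>closed_region.no_draw_near_K\<close>).

  It remains to see that clusters stop. Let \<open>S\<close> be a ball of radius \<open>r\<close> in a cluster. Up to a constant
  times the size of the next sphere, its outer neighbours are the open odd vertices all of whose
  neighbours lie in \<open>S\<close>. Without closed vertices there are fewer of these than points of \<open>S\<close>, with a
  loss at every boundary point and another one at every closed odd vertex. To turn this into a loss
  proportional to \<open>|S|\<close>, cut the lattice into blocks: a block that meets \<open>S\<close> and contains a closed
  odd vertex contributes to the loss in either case, whether \<open>S\<close> fills the block or not
  (\<open>block_isoperimetry\<close>). The inequality \<open>|F| \<le> |N(F) - N(A)|\<close> for the open part \<open>F\<close> of \<open>S\<close>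
  therefore says that the loss is paid for by closed even vertices in \<open>S\<close> or by the next sphere.

  If the blocks are large then few of them contain no closed odd vertex, and if \<open>q\<close> is small, given
  the size of the blocks, then there are few closed even vertices. By a union bound over lattice
  animals this holds, almost surely, simultaneously for all large connected sets of blocks that
  contain a given block (\<open>AE_favourable\<close>). Then the next sphere has to pay, so that the ball grows by a
  constant factor with each unit of radius. As its size is at most a power of the radius, the cluster
  stops (\<open>favourable_cluster_stops\<close>), and the game is not a draw. If moreover all even vertices are
  open, then the cluster has to be empty: a cluster that stops has fewer outer neighbours than points,
  whereas it would need at least as many (\<open>bcc_box.not_losing_if_stops\<close>). So every even vertex of
  the lattice belongs to the set \<open>A\<close> of its box and every open odd vertex to \<open>N(A)\<close> for some box, and
  Eve wins.
\<close>

section \<open>Matchings in graphs\<close>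

definition nbrs :: "('v \<Rightarrow> 'v \<Rightarrow> bool) \<Rightarrow> 'v set \<Rightarrow> 'v set" where
  "nbrs adj S = {v. \<exists>u\<in>S. adj u v}"

definition matched_into :: "('v \<Rightarrow> 'v \<Rightarrow> bool) \<Rightarrow> 'v set \<Rightarrow> 'v set \<Rightarrow> bool" where
  "matched_into adj X Y \<longleftrightarrow> (\<exists>f. inj_on f X \<and> f ` X \<subseteq> Y \<and> (\<forall>v\<in>X. adj v (f v)))"

lemma nbrs_Un: "nbrs adj (S \<union> T) = nbrs adj S \<union> nbrs adj T"
  by (auto simp: nbrs_def)

lemma nbrs_mono: "S \<subseteq> T \<Longrightarrow> nbrs adj S \<subseteq> nbrs adj T"
  by (auto simp: nbrs_def)

lemma nbrs_empty [simp]: "nbrs adj {} = {}"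
  by (simp add: nbrs_def)

lemma matched_into_mono: "matched_into adj X Y \<Longrightarrow> X' \<subseteq> X \<Longrightarrow> Y \<subseteq> Y' \<Longrightarrow> matched_into adj X' Y'"
  unfolding matched_into_def by (meson image_mono inj_on_subset subset_iff subset_trans)

lemma matched_into_Un:
  assumes "matched_into adj X1 Y1" "matched_into adj X2 Y2" "Y1 \<inter> Y2 = {}"
  shows "matched_into adj (X1 \<union> X2) (Y1 \<union> Y2)"
proof -
  obtain f where f: "inj_on f X1" "f ` X1 \<subseteq> Y1" "\<forall>v\<in>X1. adj v (f v)"
    using assms(1) by (auto simp: matched_into_def)
  obtain g where g: "inj_on g X2" "g ` X2 \<subseteq> Y2" "\<forall>v\<in>X2. adj v (g v)"
    using assms(2) by (auto simp: matched_into_def)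
  define h where "h = (\<lambda>v. if v \<in> X1 then f v else g v)"
  have "inj_on h (X1 \<union> X2)"
  proof (rule inj_onI)
    fix x y assume "x \<in> X1 \<union> X2" "y \<in> X1 \<union> X2" "h x = h y"
    moreover have "f a \<noteq> g b" if "a \<in> X1" "b \<in> X2" for a b
      using f(2) g(2) assms(3) that by blast
    ultimately show "x = y"
      using inj_onD[OF f(1), of x y] inj_onD[OF g(1), of x y] unfolding h_def
      by (metis UnE)
  qed
  moreover have "h ` (X1 \<union> X2) \<subseteq> Y1 \<union> Y2" using f g by (auto simp: h_def)
  moreover have "\<forall>v\<in>X1 \<union> X2. adj v (h v)" using f g by (auto simp: h_def)
  ultimately show ?thesis unfolding matched_into_def by blast
qed

lemma matched_into_converse:
  assumes "matched_into adj X Y" "finite X" "finite Y" "card X = card Y"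
    and sym: "\<And>u v. adj u v \<Longrightarrow> adj v u"
  shows "matched_into adj Y X"
proof -
  obtain f where f: "inj_on f X" "f ` X \<subseteq> Y" "\<forall>v\<in>X. adj v (f v)"
    using assms(1) by (auto simp: matched_into_def)
  have im: "f ` X = Y"
    using f assms(2-4) by (simp add: card_image card_subset_eq)
  have "inj_on (inv_into X f) Y" using im by (simp add: inj_on_inv_into)
  moreover have "inv_into X f ` Y \<subseteq> X" using im by (auto intro: inv_into_into)
  moreover have "\<forall>v\<in>Y. adj v (inv_into X f v)"
    using f im by (metis f_inv_into_f inv_into_into sym)
  ultimately show ?thesis unfolding matched_into_def by blast
qed

text \<open>Hall's marriage theorem, by the induction of Halmos and Vaughan: a set that is matched to
  exactly as many neighbours as it has elements splits the problem into two independent ones, and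
  if there is no such set then any single edge may be chosen.\<close>

lemma hall:
  assumes "finite X" "finite Y" "\<And>S. S \<subseteq> X \<Longrightarrow> card S \<le> card (nbrs adj S \<inter> Y)"
  shows "matched_into adj X Y"
  using assms
proof (induction "card X" arbitrary: X Y rule: less_induct)
  case less
  note finX = less.prems(1) and finY = less.prems(2) and hall = less.prems(3)
  show ?case
  proof (cases "X = {}")
    case True
    then show ?thesis by (auto simp: matched_into_def)
  next
    case nonempty: False
    show ?thesis
    proof (cases "\<exists>S0. S0 \<subset> X \<and> S0 \<noteq> {} \<and> card S0 = card (nbrs adj S0 \<inter> Y)")
      case True
      then obtain S0 where S0: "S0 \<subset> X" "S0 \<noteq> {}" "card S0 = card (nbrs adj S0 \<inter> Y)" by blast
      have finS0: "finite S0" using S0 finX by (meson finite_subset psubset_imp_subset)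
      have 1: "matched_into adj S0 (nbrs adj S0 \<inter> Y)"
      proof (rule less.hyps)
        show "card S0 < card X" using psubset_card_mono[OF finX S0(1)] .
        fix S assume S: "S \<subseteq> S0"
        then have "nbrs adj S \<inter> (nbrs adj S0 \<inter> Y) = nbrs adj S \<inter> Y"
          using nbrs_mono by blast
        then show "card S \<le> card (nbrs adj S \<inter> (nbrs adj S0 \<inter> Y))"
          using hall[of S] S S0 by auto
      qed (use finS0 finY in auto)
      have 2: "matched_into adj (X - S0) (Y - nbrs adj S0)"
      proof (rule less.hyps)
        have "card (X - S0) = card X - card S0"
          using S0(1) finS0 by (simp add: card_Diff_subset)
        moreover have "0 < card S0" using S0(2) finS0 by (simp add: card_gt_0_iff)
        moreover have "card S0 < card X" using psubset_card_mono[OF finX S0(1)] .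
        ultimately show "card (X - S0) < card X" by linarith
        fix S assume S: "S \<subseteq> X - S0"
        then have finS: "finite S" using finX finite_subset by blast
        have "card S + card S0 = card (S \<union> S0)"
          using S finS finS0 by (subst card_Un_disjoint) auto
        also have "\<dots> \<le> card (nbrs adj (S \<union> S0) \<inter> Y)" using S S0 by (intro hall) auto
        also have "nbrs adj (S \<union> S0) \<inter> Y
            = (nbrs adj S \<inter> (Y - nbrs adj S0)) \<union> (nbrs adj S0 \<inter> Y)"
          by (auto simp: nbrs_Un)
        also have "card \<dots> = card (nbrs adj S \<inter> (Y - nbrs adj S0)) + card (nbrs adj S0 \<inter> Y)"
          using finY by (intro card_Un_disjoint) auto
        finally show "card S \<le> card (nbrs adj S \<inter> (Y - nbrs adj S0))" using S0(3) by simp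
      qed (use finX finY in auto)
      have "matched_into adj (S0 \<union> (X - S0)) ((nbrs adj S0 \<inter> Y) \<union> (Y - nbrs adj S0))"
        by (intro matched_into_Un 1 2) auto
      then show ?thesis by (rule matched_into_mono) (use S0 in auto)
    next
      case False
      obtain x where x: "x \<in> X" using nonempty by blast
      have "0 < card (nbrs adj {x} \<inter> Y)" using hall[of "{x}"] x by simp
      then obtain y where y: "adj x y" "y \<in> Y"
        by (auto simp: card_gt_0_iff nbrs_def)
      have 1: "matched_into adj {x} {y}"
        unfolding matched_into_def using y by (intro exI[of _ "\<lambda>_. y"]) auto
      have 2: "matched_into adj (X - {x}) (Y - {y})"
      proof (rule less.hyps)
        show "card (X - {x}) < card X" using x finX by (rule card_Diff1_less[rotated])
        fix S assume S: "S \<subseteq> X - {x}"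
        show "card S \<le> card (nbrs adj S \<inter> (Y - {y}))"
        proof (cases "S = {}")
          case False': False
          have "S \<subset> X" using S x by auto
          then have "card S \<noteq> card (nbrs adj S \<inter> Y)" using False False' by blast
          with hall[of S] \<open>S \<subset> X\<close> have "card S < card (nbrs adj S \<inter> Y)"
            by (metis le_neq_implies_less psubset_imp_subset)
          also have "\<dots> \<le> card (insert y (nbrs adj S \<inter> (Y - {y})))"
            using finY by (intro card_mono) auto
          also have "\<dots> \<le> Suc (card (nbrs adj S \<inter> (Y - {y})))"
            by (simp add: card_insert_le_m1 card_insert_if finY)
          finally show ?thesis by simp
        qed simp
      qed (use finX finY in auto)
      have "matched_into adj ({x} \<union> (X - {x})) ({y} \<union> (Y - {y}))"
        by (intro matched_into_Un 1 2) auto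
      then show ?thesis by (rule matched_into_mono) (use x y in auto)
    qed
  qed
qed

section \<open>Matchings as strategies\<close>

lemma trap_move_step:
  assumes "trap_strategy adj \<sigma>" "trap_strategy adj \<tau>" "trap_moves adj (trap_play \<sigma> \<tau> x n) \<noteq> {}"
    and "y = (if even n then \<sigma> (trap_play \<sigma> \<tau> x n) else \<tau> (trap_play \<sigma> \<tau> x n))"
  shows "trap_play \<sigma> \<tau> x (Suc n) = (y, insert y (snd (trap_play \<sigma> \<tau> x n)))"
    "adj (fst (trap_play \<sigma> \<tau> x n)) y" "y \<notin> snd (trap_play \<sigma> \<tau> x n)"
proof -
  have "y \<in> trap_moves adj (trap_play \<sigma> \<tau> x n)"
    using assms unfolding trap_strategy_def by metis
  then show "adj (fst (trap_play \<sigma> \<tau> x n)) y" "y \<notin> snd (trap_play \<sigma> \<tau> x n)"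
    by (auto simp: trap_moves_def)
  show "trap_play \<sigma> \<tau> x (Suc n) = (y, insert y (snd (trap_play \<sigma> \<tau> x n)))"
    using assms(4) by (simp add: Let_def)
qed

definition matching_strategy ::
    "('v \<Rightarrow> 'v \<Rightarrow> bool) \<Rightarrow> 'v set \<Rightarrow> ('v \<Rightarrow> 'v) \<Rightarrow> 'v strategy" where
  "matching_strategy adj F f pos =
    (if fst pos \<in> nbrs adj F \<and> f (fst pos) \<notin> snd pos then f (fst pos)
     else SOME y. y \<in> trap_moves adj pos)"

lemma trap_strategy_matching_strategy:
  assumes "\<And>v. v \<in> nbrs adj F \<Longrightarrow> adj v (f v)"
  shows "trap_strategy adj (matching_strategy adj F f)"
  unfolding trap_strategy_def
proof (intro allI impI)
  fix pos assume "trap_moves adj pos \<noteq> {}"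
  then have "(SOME y. y \<in> trap_moves adj pos) \<in> trap_moves adj pos" by (simp add: some_in_eq)
  then show "matching_strategy adj F f pos \<in> trap_moves adj pos"
    using assms[of "fst pos"] by (simp add: matching_strategy_def trap_moves_def)
qed

text \<open>The player who always answers along a matching of the neighbourhood of \<open>F\<close> into \<open>F\<close> keeps
  the token inside the finite set formed by \<open>F\<close> and its neighbours, so the play ends. She is never
  stuck, because every visited vertex of \<open>F\<close> is the partner of a vertex that was visited just
  before it, except for the initial vertex, which belongs to \<open>F\<close> only if it has no partner. The
  truth value \<open>c\<close> tells whether she moves first.\<close>

lemma matching_strategy_wins:
  assumes fin: "finite F" and bip: "F \<inter> nbrs adj F = {}"
    and f: "inj_on f (nbrs adj F)" "f ` nbrs adj F \<subseteq> F" "\<And>v. v \<in> nbrs adj F \<Longrightarrow> adj v (f v)"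
    and start: "if c then x \<in> nbrs adj F else x \<in> F - f ` nbrs adj F"
    and strat: "trap_strategy adj \<sigma>" "trap_strategy adj \<tau>"
    and resp: "(if c then \<sigma> else \<tau>) = matching_strategy adj F f"
  shows "\<exists>n. (even n \<longleftrightarrow> \<not> c) \<and> trap_ends_at adj \<sigma> \<tau> x n"
proof -
  define loc where "loc n = fst (trap_play \<sigma> \<tau> x n)" for n
  define vis where "vis n = snd (trap_play \<sigma> \<tau> x n)" for n
  define live where "live n \<longleftrightarrow> (\<forall>m<n. trap_moves adj (trap_play \<sigma> \<tau> x m) \<noteq> {})" for n
  have finN: "finite (nbrs adj F)" using f(1,2) fin by (meson inj_on_finite)
  define inv where "inv n \<longleftrightarrow> loc n \<in> vis n \<and> card (vis n) = Suc n \<and> vis n \<subseteq> F \<union> nbrs adj F \<and>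
      (if even n \<longleftrightarrow> c then loc n \<in> nbrs adj F \<and> f (loc n) \<notin> vis n else loc n \<in> F) \<and>
      (\<forall>u\<in>vis n \<inter> F. u \<notin> f ` nbrs adj F \<or> u \<in> f ` (vis n \<inter> nbrs adj F))" for n
  have inv: "inv n" if "live n" for n
    using that
  proof (induction n)
    case 0
    have "f x \<in> F \<and> x \<noteq> f x" if c using that start f(2) bip by auto
    then show ?case
      using start bip unfolding inv_def loc_def vis_def by (auto split: if_splits)
  next
    case (Suc n)
    have ne: "trap_moves adj (trap_play \<sigma> \<tau> x n) \<noteq> {}" and "live n"
      using Suc.prems by (auto simp: live_def)
    then have I: "inv n" using Suc.IH by blast
    define y where
      "y = (if even n then \<sigma> (trap_play \<sigma> \<tau> x n) else \<tau> (trap_play \<sigma> \<tau> x n))"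
    note step = trap_move_step[OF strat ne y_def]
    have loc': "loc (Suc n) = y" and vis': "vis (Suc n) = insert y (vis n)"
      and adj: "adj (loc n) y" and new: "y \<notin> vis n"
      using step by (simp_all add: loc_def vis_def)
    have finv: "finite (vis n)"
      using I fin finN unfolding inv_def by (meson finite_UnI finite_subset)
    have cd: "card (vis (Suc n)) = Suc (Suc n)"
      using I finv new by (simp add: inv_def vis')
    show ?case
    proof (cases "even n \<longleftrightarrow> c")
      case True
      then have l: "loc n \<in> nbrs adj F" "f (loc n) \<notin> vis n" using I by (auto simp: inv_def)
      have "y = matching_strategy adj F f (trap_play \<sigma> \<tau> x n)"
        using True resp by (auto simp: y_def split: if_splits)
      then have y: "y = f (loc n)" using l by (simp add: matching_strategy_def loc_def vis_def)
      have yF: "y \<in> F" using y l f(2) by auto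
      show ?thesis
        using True I cd yF l y unfolding inv_def loc' vis' by auto
    next
      case False
      then have l: "loc n \<in> F" using I by (auto simp: inv_def)
      then have yN: "y \<in> nbrs adj F" using adj by (auto simp: nbrs_def)
      have fy: "f y \<in> F" using yN f(2) by auto
      have "f y \<notin> vis n"
      proof
        assume "f y \<in> vis n"
        then have "f y \<in> f ` (vis n \<inter> nbrs adj F)" using I fy yN unfolding inv_def by blast
        then have "y \<in> vis n" using f(1) yN by (auto dest: inj_onD)
        then show False using new by simp
      qed
      moreover have "f y \<noteq> y" using fy yN bip by auto
      ultimately show ?thesis
        using False I cd yN bip unfolding inv_def loc' vis' by auto
    qed
  qed
  have "\<exists>n. trap_moves adj (trap_play \<sigma> \<tau> x n) = {}"
  proof (rule ccontr)
    assume "\<not> ?thesis"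
    then have "inv n" for n by (intro inv) (auto simp: live_def)
    then have "Suc n \<le> card (F \<union> nbrs adj F)" for n
      using fin finN unfolding inv_def by (metis card_mono finite_UnI)
    then show False using not_less_eq_eq by blast
  qed
  then obtain n where n: "trap_moves adj (trap_play \<sigma> \<tau> x n) = {}" "live n"
    using exists_least_iff[of "\<lambda>n. trap_moves adj (trap_play \<sigma> \<tau> x n) = {}"]
    by (auto simp: live_def)
  have "\<not> (even n \<longleftrightarrow> c)"
  proof
    assume "even n \<longleftrightarrow> c"
    then have l: "loc n \<in> nbrs adj F" "f (loc n) \<notin> vis n" using inv[OF n(2)] by (auto simp: inv_def)
    then have "f (loc n) \<in> trap_moves adj (trap_play \<sigma> \<tau> x n)"
      using f(3) by (auto simp: trap_moves_def loc_def vis_def)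
    then show False using n by simp
  qed
  then show ?thesis using n by (auto simp: trap_ends_at_def live_def)
qed

lemma second_wins_if_matched:
  assumes "finite F" "F \<inter> nbrs adj F = {}" "x \<in> F" "matched_into adj (nbrs adj F) (F - {x})"
  shows "trap_second_wins adj x"
proof -
  obtain f where f: "inj_on f (nbrs adj F)" "f ` nbrs adj F \<subseteq> F - {x}" "\<forall>v\<in>nbrs adj F. adj v (f v)"
    using assms(4) by (auto simp: matched_into_def)
  have s: "trap_strategy adj (matching_strategy adj F f)"
    using f by (intro trap_strategy_matching_strategy) auto
  moreover have "\<exists>n. even n \<and> trap_ends_at adj \<sigma> (matching_strategy adj F f) x n"
    if "trap_strategy adj \<sigma>" for \<sigma>
    using matching_strategy_wins[of F adj f False x \<sigma> "matching_strategy adj F f"] f assms s that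
    by auto
  ultimately show ?thesis unfolding trap_second_wins_def by blast
qed

lemma first_wins_if_matched:
  assumes "finite F" "F \<inter> nbrs adj F = {}" "x \<in> nbrs adj F" "matched_into adj (nbrs adj F) F"
  shows "trap_first_wins adj x"
proof -
  obtain f where f: "inj_on f (nbrs adj F)" "f ` nbrs adj F \<subseteq> F" "\<forall>v\<in>nbrs adj F. adj v (f v)"
    using assms(4) by (auto simp: matched_into_def)
  have s: "trap_strategy adj (matching_strategy adj F f)"
    using f by (intro trap_strategy_matching_strategy) auto
  moreover have "\<exists>n. odd n \<and> trap_ends_at adj (matching_strategy adj F f) \<tau> x n"
    if "trap_strategy adj \<tau>" for \<tau>
    using matching_strategy_wins[of F adj f True x "matching_strategy adj F f" \<tau>] f assms s that
    by auto
  ultimately show ?thesis unfolding trap_first_wins_def by blast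
qed

section \<open>Sets of maximal deficiency\<close>

text \<open>The deficiency of a set is its excess in cardinality over its neighbourhood. The witness is a
  set of maximal deficiency which, among those, has least cardinality; minimality is what allows
  its neighbourhood to be matched without using a prescribed vertex.\<close>

lemma exists_minimal_max_deficiency:
  assumes fin: "finite \<Lambda>" and lf: "\<And>F. finite F \<Longrightarrow> finite (nbrs adj F)"
    and sym: "\<And>u v. adj u v \<Longrightarrow> adj v u"
  obtains A where "A \<subseteq> \<Lambda>"
    "\<And>F. F \<subseteq> \<Lambda> \<Longrightarrow> card F + card (nbrs adj A) \<le> card A + card (nbrs adj F)"
    "\<And>x. x \<in> A \<Longrightarrow> matched_into adj (nbrs adj A) (A - {x})"
proof -
  define d where "d F = int (card F) - int (card (nbrs adj F))" for F
  have img: "finite (d ` Pow \<Lambda>)" "d ` Pow \<Lambda> \<noteq> {}" using fin by auto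
  obtain A0 where A0: "A0 \<in> Pow \<Lambda>" "d A0 = Max (d ` Pow \<Lambda>)"
    using Max_in[OF img] by auto
  have A0_max: "d F \<le> d A0" if "F \<subseteq> \<Lambda>" for F
    unfolding A0(2) using that img by (intro Max_ge) auto
  define P where "P A \<longleftrightarrow> A \<subseteq> \<Lambda> \<and> d A = d A0" for A
  have "P A0" using A0 by (auto simp: P_def)
  then obtain A where A: "P A" "\<And>B. P B \<Longrightarrow> card A \<le> card B"
    using ex_has_least_nat[of P A0 card] by blast
  have AL: "A \<subseteq> \<Lambda>" and max: "\<And>F. F \<subseteq> \<Lambda> \<Longrightarrow> d F \<le> d A" using A A0_max by (auto simp: P_def)
  have finA: "finite A" using AL fin finite_subset by blast
  show thesis
  proof
    show "A \<subseteq> \<Lambda>" by (rule AL)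
    show "card F + card (nbrs adj A) \<le> card A + card (nbrs adj F)" if "F \<subseteq> \<Lambda>" for F
      using max[OF that] by (auto simp: d_def)
    show "matched_into adj (nbrs adj A) (A - {x})" if x: "x \<in> A" for x
    proof (rule hall)
      show "finite (nbrs adj A)" "finite (A - {x})" using finA lf by auto
      fix T assume T: "T \<subseteq> nbrs adj A"
      show "card T \<le> card (nbrs adj T \<inter> (A - {x}))"
      proof (cases "T = {}")
        case False
        define S where "S = nbrs adj T \<inter> A"
        have finS: "finite S" using finA by (simp add: S_def)
        have finT: "finite T" using T lf[OF finA] finite_subset by blast
        \<comment> \<open>Removing \<open>S\<close> from \<open>A\<close> loses all of \<open>T\<close> from the neighbourhood, so by minimality of \<open>A\<close>
            the set \<open>T\<close> is smaller than \<open>S\<close>.\<close>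
        have "S \<noteq> {}"
        proof -
          obtain v where "v \<in> T" using False by blast
          then obtain u where "u \<in> A" "adj u v" using T by (auto simp: nbrs_def)
          then have "u \<in> S" using \<open>v \<in> T\<close> sym by (auto simp: S_def nbrs_def)
          then show ?thesis by blast
        qed
        have cS: "card (A - S) + card S = card A" "card S > 0"
          using finA finS \<open>S \<noteq> {}\<close> card_mono[of A S]
          by (auto simp: S_def card_Diff_subset card_gt_0_iff)
        then have "\<not> P (A - S)" using A(2)[of "A - S"] by auto
        then have "d (A - S) \<noteq> d A" using A(1) AL by (auto simp: P_def)
        moreover have "d (A - S) \<le> d A" using AL by (intro max) auto
        ultimately have "d (A - S) < d A" by simp
        moreover have "card (nbrs adj (A - S)) + card T \<le> card (nbrs adj A)"
        proof -
          have "nbrs adj (A - S) \<inter> T = {}"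
            using sym by (auto simp: S_def nbrs_def)
          then have "card (nbrs adj (A - S)) + card T = card (nbrs adj (A - S) \<union> T)"
            using finT lf[of "A - S"] finA by (simp add: card_Un_disjoint)
          also have "\<dots> \<le> card (nbrs adj A)"
            using T lf[OF finA] by (intro card_mono) (auto simp: nbrs_def)
          finally show ?thesis .
        qed
        ultimately have "card T < card S" using cS(1) unfolding d_def by linarith
        moreover have "card S - 1 \<le> card (S - {x})"
          using card_Diff_singleton_if[of S x] by simp
        moreover have "S - {x} = nbrs adj T \<inter> (A - {x})" by (auto simp: S_def)
        ultimately show ?thesis by simp
      qed simp
    qed
  qed
qed

text \<open>Otherwise \<open>F \<union> A\<close> would have a larger deficiency than \<open>A\<close>.\<close>

lemma card_le_outer_nbrs:
  assumes "finite \<Lambda>" and lf: "\<And>F. finite F \<Longrightarrow> finite (nbrs adj F)" and "A \<subseteq> \<Lambda>"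
    and max: "\<And>F. F \<subseteq> \<Lambda> \<Longrightarrow> card F + card (nbrs adj A) \<le> card A + card (nbrs adj F)"
    and F: "F \<subseteq> \<Lambda> - A"
  shows "card F \<le> card (nbrs adj F - nbrs adj A)"
proof -
  have fin: "finite A" "finite F"
    using assms(1,3) F by (auto intro: finite_subset[of _ \<Lambda>])
  have "card (F \<union> A) = card F + card A" using F fin by (intro card_Un_disjoint) auto
  moreover have "card (nbrs adj (F \<union> A)) = card (nbrs adj F - nbrs adj A) + card (nbrs adj A)"
  proof -
    have "nbrs adj (F \<union> A) = (nbrs adj F - nbrs adj A) \<union> nbrs adj A" by (auto simp: nbrs_Un)
    then show ?thesis using lf fin by (simp only:) (intro card_Un_disjoint, auto)
  qed
  moreover have "card (F \<union> A) + card (nbrs adj A) \<le> card A + card (nbrs adj (F \<union> A))"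
    using assms(3) F by (intro max) auto
  ultimately show ?thesis by linarith
qed

text \<open>\<open>E\<close> is one side of a bipartite graph, and \<open>\<Lambda>\<close> is the finite part of it in which \<open>A\<close> is a
  set as in the previous two lemmas.\<close>

locale max_deficiency =
  fixes adj :: "'v \<Rightarrow> 'v \<Rightarrow> bool" and \<Lambda> E A :: "'v set"
  assumes sym: "adj u v \<Longrightarrow> adj v u"
    and locally_finite: "finite F \<Longrightarrow> finite (nbrs adj F)"
    and bipartite: "adj u v \<Longrightarrow> u \<in> E \<longleftrightarrow> v \<notin> E"
    and finite_\<Lambda>: "finite \<Lambda>" and \<Lambda>_E: "\<Lambda> \<subseteq> E" and A_\<Lambda>: "A \<subseteq> \<Lambda>"
    and max: "F \<subseteq> \<Lambda> \<Longrightarrow> card F + card (nbrs adj A) \<le> card A + card (nbrs adj F)"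
    and critical: "x \<in> A \<Longrightarrow> matched_into adj (nbrs adj A) (A - {x})"
begin

lemma finite_A: "finite A" using A_\<Lambda> finite_\<Lambda> finite_subset by blast

lemma E_disjoint_nbrs: "F \<subseteq> E \<Longrightarrow> F \<inter> nbrs adj F = {}"
  using bipartite by (auto simp: nbrs_def)

lemma matched_A: "matched_into adj (nbrs adj A) A"
proof (cases "A = {}")
  case True
  then show ?thesis by (simp add: matched_into_def)
next
  case False
  then obtain x where "x \<in> A" by blast
  from critical[OF this] show ?thesis by (rule matched_into_mono) auto
qed

lemma outer_surplus: "F \<subseteq> \<Lambda> - A \<Longrightarrow> card F \<le> card (nbrs adj F - nbrs adj A)"
  using card_le_outer_nbrs[OF finite_\<Lambda> locally_finite A_\<Lambda> max] by blast

lemma second_wins_in_A: "x \<in> A \<Longrightarrow> trap_second_wins adj x"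
  using finite_A E_disjoint_nbrs[of A] A_\<Lambda> \<Lambda>_E critical by (intro second_wins_if_matched[of A]) auto

lemma first_wins_near_A: "x \<in> nbrs adj A \<Longrightarrow> trap_first_wins adj x"
  using finite_A E_disjoint_nbrs[of A] A_\<Lambda> \<Lambda>_E matched_A by (intro first_wins_if_matched[of A]) auto

end

text \<open>The token can leave \<open>K\<close> and its neighbourhood only through \<open>nbrs adj A\<close>, from where the player
  who moves into \<open>E\<close> wins.\<close>

locale closed_region = max_deficiency +
  fixes K :: "'a set"
  assumes K: "K \<subseteq> \<Lambda> - A"
    and closed: "v \<in> nbrs adj K - nbrs adj A \<Longrightarrow> nbrs adj {v} \<subseteq> K"
begin

lemma finite_K: "finite K" using K finite_\<Lambda> finite_subset by blast

lemma outer_not_E: "v \<in> nbrs adj K \<Longrightarrow> v \<notin> E"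
  using K \<Lambda>_E bipartite by (auto simp: nbrs_def)

lemma nbrs_disjoint: "F \<inter> E = {} \<Longrightarrow> F \<inter> nbrs adj F = {}"
  using bipartite by (auto simp: nbrs_def)

text \<open>Hall's condition holds on \<open>K\<close> by maximality of \<open>A\<close>, so the player who moves out of \<open>K\<close> can
  answer along a matching into vertices from which \<open>A\<close> cannot be reached in one move.\<close>

lemma first_wins_in_K:
  assumes "x \<in> K"
  shows "trap_first_wins adj x"
proof -
  define G where "G = nbrs adj K - nbrs adj A"
  have finG: "finite G" using locally_finite finite_K by (simp add: G_def)
  have m: "matched_into adj K G"
  proof (rule hall[OF finite_K finG])
    fix S assume "S \<subseteq> K"
    then have "card S \<le> card (nbrs adj S - nbrs adj A)" using K by (intro outer_surplus) auto
    also have "nbrs adj S - nbrs adj A = nbrs adj S \<inter> G"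
      using \<open>S \<subseteq> K\<close> nbrs_mono[of S K adj] by (auto simp: G_def)
    finally show "card S \<le> card (nbrs adj S \<inter> G)" .
  qed
  have NG: "nbrs adj G \<subseteq> K" using closed by (force simp: G_def nbrs_def)
  show ?thesis
  proof (rule first_wins_if_matched[OF finG])
    show "G \<inter> nbrs adj G = {}" using outer_not_E by (intro nbrs_disjoint) (auto simp: G_def)
    show "matched_into adj (nbrs adj G) G" using m NG by (rule matched_into_mono) simp
    obtain f where "f ` K \<subseteq> G" "\<forall>v\<in>K. adj v (f v)" using m by (auto simp: matched_into_def)
    then have "f x \<in> G" "adj (f x) x" using assms sym by auto
    then show "x \<in> nbrs adj G" by (auto simp: nbrs_def)
  qed
qed

text \<open>From a vertex \<open>x\<close> on the other side of the graph, either \<open>K\<close> can still be matched without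
  \<open>x\<close>, and then the second player answers along this matching, or a subset of \<open>K\<close> for which
  Hall's condition fails without \<open>x\<close> is perfectly matched with its outer neighbourhood, and then
  the first player enters this subset from \<open>x\<close> and answers along the two matchings.\<close>

lemma no_draw_near_K:
  assumes xE: "x \<notin> E" and xK: "nbrs adj {x} \<subseteq> K"
  shows "trap_first_wins adj x \<or> trap_second_wins adj x"
proof (cases "matched_into adj K (nbrs adj K - nbrs adj A - {x})")
  case True
  define G where "G = insert x (nbrs adj K - nbrs adj A)"
  have finG: "finite G" using locally_finite finite_K by (simp add: G_def)
  have NG: "nbrs adj G \<subseteq> K" using closed xK by (force simp: G_def nbrs_def)
  have "trap_second_wins adj x"
  proof (rule second_wins_if_matched[OF finG])
    show "G \<inter> nbrs adj G = {}" using outer_not_E xE by (intro nbrs_disjoint) (auto simp: G_def)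
    show "x \<in> G" by (simp add: G_def)
    show "matched_into adj (nbrs adj G) (G - {x})"
      using True NG by (rule matched_into_mono) (auto simp: G_def)
  qed
  then show ?thesis ..
next
  case False
  define G where "G = nbrs adj K - nbrs adj A"
  have finG: "finite (G - {x})" using locally_finite finite_K by (simp add: G_def)
  obtain S where S: "S \<subseteq> K" "card (nbrs adj S \<inter> (G - {x})) < card S"
    using False hall[OF finite_K finG, of adj] unfolding G_def by (meson not_le)
  define T where "T = nbrs adj S - nbrs adj A"
  have finS: "finite S" using S finite_K finite_subset by blast
  have finT: "finite T" using locally_finite finS by (simp add: T_def)
  have T': "nbrs adj S \<inter> (G - {x}) = T - {x}"
    using S(1) nbrs_mono[of S K adj] by (auto simp: G_def T_def)
  have le: "card R \<le> card (nbrs adj R - nbrs adj A)" if "R \<subseteq> S" for R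
    using that S K by (intro outer_surplus) auto
  have xT: "x \<in> T"
  proof (rule ccontr)
    assume "x \<notin> T"
    then have "T - {x} = T" by simp
    then show False using le[of S] S(2) T' by (simp add: T_def[symmetric])
  qed
  have cT: "card S = card T"
    using le[of S] S(2) T' xT finT by (simp add: T_def[symmetric])
  have S_T: "matched_into adj S T"
  proof (rule hall[OF finS finT])
    fix R assume R: "R \<subseteq> S"
    have "nbrs adj R \<inter> T = nbrs adj R - nbrs adj A"
      using R nbrs_mono[of R S adj] by (auto simp: T_def)
    then show "card R \<le> card (nbrs adj R \<inter> T)" using le[OF R] by simp
  qed
  have "matched_into adj T S" by (rule matched_into_converse[OF S_T finS finT cT sym])
  then have "matched_into adj (nbrs adj A \<union> T) (A \<union> S)"
    using matched_A S(1) K by (intro matched_into_Un) auto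
  moreover have "nbrs adj A \<union> T = nbrs adj (A \<union> S)" by (auto simp: T_def nbrs_Un)
  ultimately have m: "matched_into adj (nbrs adj (A \<union> S)) (A \<union> S)" by simp
  have "trap_first_wins adj x"
  proof (rule first_wins_if_matched[OF _ _ _ m])
    show "finite (A \<union> S)" using finite_A finS by simp
    show "(A \<union> S) \<inter> nbrs adj (A \<union> S) = {}"
      using A_\<Lambda> \<Lambda>_E S K by (intro E_disjoint_nbrs) auto
    show "x \<in> nbrs adj (A \<union> S)" using xT by (auto simp: T_def nbrs_Un)
  qed
  then show ?thesis ..
qed

end

section \<open>Blocks of the integer lattice\<close>

lemma finite_card_vec_box:
  fixes S :: "'d::finite \<Rightarrow> 'a set"
  assumes "\<And>i. finite (S i)"
  shows "finite {v :: 'a ^ 'd. \<forall>i. v $ i \<in> S i}"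
    and "card {v :: 'a ^ 'd. \<forall>i. v $ i \<in> S i} = (\<Prod>i\<in>UNIV. card (S i))"
proof -
  have bij: "bij_betw vec_nth {v :: 'a ^ 'd. \<forall>i. v $ i \<in> S i} (PiE UNIV S)"
    by (rule bij_betw_byWitness[where f' = vec_lambda]) auto
  have fin: "finite (PiE UNIV S)" using assms by (intro finite_PiE) auto
  show "finite {v :: 'a ^ 'd. \<forall>i. v $ i \<in> S i}" using bij fin bij_betw_finite by blast
  show "card {v :: 'a ^ 'd. \<forall>i. v $ i \<in> S i} = (\<Prod>i\<in>UNIV. card (S i))"
    using bij_betw_same_card[OF bij] by (simp add: card_PiE)
qed

lemma
  fixes S :: "'a set"
  assumes "finite S"
  shows finite_vec_power: "finite {v :: 'a ^ 'd::finite. \<forall>i. v $ i \<in> S}"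
    and card_vec_power: "card {v :: 'a ^ 'd::finite. \<forall>i. v $ i \<in> S} = card S ^ CARD('d)"
  using finite_card_vec_box[of "\<lambda>_ :: 'd. S"] assms by simp_all

definition near :: "int ^ 'd \<Rightarrow> int ^ 'd \<Rightarrow> bool" where
  "near a b \<longleftrightarrow> (\<forall>i. \<bar>a $ i - b $ i\<bar> \<le> 1)"

definition unit_cube :: "(int ^ 'd) set" where
  "unit_cube = {c. \<forall>i. c $ i \<in> {0, 1}}"

definition block :: "int \<Rightarrow> int ^ 'd \<Rightarrow> int ^ 'd" where
  "block L a = (\<chi> i. a $ i div L)"

lemma near_refl [simp]: "near a a"
  by (simp add: near_def)

lemma finite_unit_cube [simp]: "finite (unit_cube :: (int ^ 'd::finite) set)"
  and card_unit_cube: "card (unit_cube :: (int ^ 'd::finite) set) = 2 ^ CARD('d)"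
  using finite_vec_power[of "{0, 1 :: int}", where ?'d = 'd]
    card_vec_power[of "{0, 1 :: int}", where ?'d = 'd]
  by (simp_all add: unit_cube_def numeral_2_eq_2)

lemma zero_in_unit_cube [simp]: "0 \<in> unit_cube"
  by (simp add: unit_cube_def)

lemma near_unit_cube: "c \<in> unit_cube \<Longrightarrow> c' \<in> unit_cube \<Longrightarrow> near (b + c) (b + c')"
  unfolding near_def unit_cube_def
proof (intro allI)
  fix i assume "c \<in> {c. \<forall>i. c $ i \<in> {0, 1}}" "c' \<in> {c. \<forall>i. c $ i \<in> {0, 1}}"
  then have "c $ i = 0 \<or> c $ i = 1" "c' $ i = 0 \<or> c' $ i = 1" by auto
  then show "\<bar>(b + c) $ i - (b + c') $ i\<bar> \<le> 1" by auto
qed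

lemma near_common_corner:
  assumes "near u u'"
  obtains b c c' where "c \<in> unit_cube" "c' \<in> unit_cube" "u = b + c" "u' = b + c'"
proof
  define b where "b = (\<chi> i. min (u $ i) (u' $ i))"
  have "\<bar>u $ i - u' $ i\<bar> \<le> 1" for i using assms by (simp add: near_def)
  then have "u $ i - b $ i = 0 \<or> u $ i - b $ i = 1" "u' $ i - b $ i = 0 \<or> u' $ i - b $ i = 1" for i
    unfolding b_def by (simp_all add: min_def) (smt (verit))+
  then show "u - b \<in> unit_cube" "u' - b \<in> unit_cube" by (auto simp: unit_cube_def)
qed simp_all

lemma near_block: "near a b \<Longrightarrow> 0 < L \<Longrightarrow> near (block L a) (block L b)"
  unfolding near_def
proof (intro allI)
  fix i assume near: "\<forall>i. \<bar>a $ i - b $ i\<bar> \<le> 1" and L: "0 < L"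
  then have "a $ i \<le> b $ i + L" "b $ i \<le> a $ i + L" using spec[OF near, of i] by linarith+
  then have "a $ i div L \<le> (b $ i + L) div L" "b $ i div L \<le> (a $ i + L) div L"
    using L by (intro zdiv_mono1; simp)+
  then show "\<bar>block L a $ i - block L b $ i\<bar> \<le> 1" using L by (simp add: block_def)
qed

lemma finite_card_block:
  fixes Q :: "int ^ 'd::finite"
  assumes "0 < L"
  shows "finite {a. block L a = Q}" and "card {a. block L a = Q} = nat L ^ CARD('d)"
proof -
  define S where "S i = {L * (Q $ i) ..< L * (Q $ i) + L}" for i
  have "x div L = q \<longleftrightarrow> x \<in> {L * q ..< L * q + L}" for x q
  proof
    assume "x div L = q"
    then have "x = L * q + x mod L" by (metis mult_div_mod_eq)
    then show "x \<in> {L * q ..< L * q + L}"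
      using pos_mod_sign[OF assms, of x] pos_mod_bound[OF assms, of x] by (simp del: pos_mod_sign)
  next
    assume "x \<in> {L * q ..< L * q + L}"
    then show "x div L = q" by (intro int_div_pos_eq[of x L q "x - L * q"]) auto
  qed
  then have *: "{a. block L a = Q} = {a. \<forall>i. a $ i \<in> S i}"
    by (auto simp: block_def S_def vec_eq_iff)
  have "finite (S i)" for i by (simp add: S_def)
  from finite_card_vec_box[of S, OF this] show "finite {a. block L a = Q}"
    "card {a. block L a = Q} = nat L ^ CARD('d)"
    unfolding * by (simp_all add: S_def)
qed

text \<open>A block is connected: a token moves straight towards its target, one unit in every
  coordinate at a time.\<close>

lemma block_connected:
  fixes a a' :: "int ^ 'd"
  assumes L: "0 < L" and "block L a' = block L a" "a \<in> S"
    and step: "\<And>u v. u \<in> S \<Longrightarrow> near u v \<Longrightarrow> block L u = block L a \<Longrightarrow> block L v = block L a \<Longrightarrow> v \<in> S"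
  shows "a' \<in> S"
proof -
  have "a' \<in> S" if "\<forall>i. \<bar>a' $ i - b $ i\<bar> \<le> int n" "block L b = block L a" "b \<in> S" for n b
    using that
  proof (induction n arbitrary: b)
    case 0
    then have "a' = b" by (simp add: vec_eq_iff)
    then show ?case using 0 by simp
  next
    case (Suc n)
    define b' where "b' = (\<chi> i. b $ i + sgn (a' $ i - b $ i))"
    have near: "near b b'" by (simp add: near_def b'_def sgn_if)
    have "block L b' $ i = block L a $ i" for i
    proof -
      have eq: "b $ i div L = a $ i div L" "a' $ i div L = a $ i div L"
        using Suc.prems(2) assms(2) by (auto simp: block_def vec_eq_iff)
      have "b $ i \<le> b' $ i \<and> b' $ i \<le> a' $ i \<or> a' $ i \<le> b' $ i \<and> b' $ i \<le> b $ i"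
        by (auto simp: b'_def sgn_if)
      then have "b' $ i div L = a $ i div L"
        using eq zdiv_mono1[OF _ L] by (metis order_antisym)
      then show ?thesis by (simp add: block_def)
    qed
    then have b': "block L b' = block L a" by (simp add: vec_eq_iff)
    moreover have "b' \<in> S" using step[OF _ near _ b'] Suc.prems by simp
    moreover have "\<bar>a' $ i - b' $ i\<bar> \<le> int n" for i
    proof -
      have "\<bar>a' $ i - b $ i\<bar> \<le> int n + 1" using Suc.prems(1) by (simp add: add.commute)
      then show ?thesis by (auto simp: b'_def sgn_if)
    qed
    ultimately show ?case using Suc.IH by blast
  qed
  moreover have "\<forall>i. \<bar>a' $ i - a $ i\<bar> \<le> int (\<Sum>i\<in>UNIV. nat \<bar>a' $ i - a $ i\<bar>)"
    by (auto intro!: member_le_sum)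
  ultimately show ?thesis using assms by blast
qed

text \<open>Every pair \<open>(u, c)\<close> with \<open>u \<in> S\<close> such that the cube of corner \<open>u - c\<close> does not lie in \<open>S\<close> or
  has its corner in \<open>W\<close> witnesses that \<open>S\<close> has fewer admissible cubes than points. A block that
  meets \<open>S\<close> and contains no first coordinate of a witness is filled by \<open>S\<close>, because then all
  neighbours in the block of a point of \<open>S\<close> lie in \<open>S\<close>; so it contains no point of \<open>W\<close>.\<close>

lemma block_isoperimetry:
  fixes S W :: "(int ^ 'd::finite) set"
  assumes L: "0 < L" and fin: "finite S"
  defines "I \<equiv> {b. b \<notin> W \<and> (\<forall>c\<in>unit_cube. b + c \<in> S)}"
  shows "card (block L ` S \<inter> block L ` W) + 2 ^ CARD('d) * card I \<le> 2 ^ CARD('d) * card S"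
proof -
  define g where "g = (\<lambda>(b :: int ^ 'd, c). (b + c, c))"
  have "I \<subseteq> S"
  proof
    fix b assume "b \<in> I"
    then have "\<forall>c\<in>unit_cube. b + c \<in> S" by (simp add: I_def)
    from bspec[OF this zero_in_unit_cube] show "b \<in> S" by simp
  qed
  then have finI: "finite I" using fin finite_subset by blast
  have inj: "inj_on g (I \<times> unit_cube)" by (auto simp: g_def inj_on_def)
  have sub: "g ` (I \<times> unit_cube) \<subseteq> S \<times> unit_cube" by (auto simp: g_def I_def)
  define R where "R = S \<times> unit_cube - g ` (I \<times> unit_cube)"
  have "block L ` S \<inter> block L ` W \<subseteq> (\<lambda>(u, c). block L u) ` R"
  proof
    fix Q assume "Q \<in> block L ` S \<inter> block L ` W"
    then obtain u w where u: "u \<in> S" "Q = block L u" and w: "w \<in> W" "Q = block L w" by blast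
    show "Q \<in> (\<lambda>(u, c). block L u) ` R"
    proof (rule ccontr)
      assume no: "Q \<notin> (\<lambda>(u, c). block L u) ` R"
      have I: "b \<in> I" if "b + c \<in> S" "block L (b + c) = Q" "c \<in> unit_cube" for b c
      proof -
        have "(b + c, c) \<notin> R" using no that(2) by force
        then have "(b + c, c) \<in> g ` (I \<times> unit_cube)" using that by (auto simp: R_def)
        then show ?thesis by (auto simp: g_def)
      qed
      have "w \<in> S"
      proof (rule block_connected[OF L _ u(1)])
        show "block L w = block L u" using u w by simp
        fix x y assume x: "x \<in> S" "near x y" "block L x = block L u"
        obtain b c c' where b: "c \<in> unit_cube" "c' \<in> unit_cube" "x = b + c" "y = b + c'"
          using near_common_corner[OF x(2)] by blast
        have "b + c \<in> S" "block L (b + c) = Q" using x u(2) b(3) by simp_all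
        then have "b \<in> I" using b(1) by (rule I)
        then show "y \<in> S" using b by (auto simp: I_def)
      qed
      then have "w \<in> I" using I[of w 0] w by simp
      then show False using w by (simp add: I_def)
    qed
  qed
  then have "card (block L ` S \<inter> block L ` W) \<le> card R"
    using fin by (intro surj_card_le) (simp_all add: R_def)
  also have "card R + card (I \<times> (unit_cube :: (int ^ 'd) set))
      = card (S \<times> (unit_cube :: (int ^ 'd) set))"
  proof -
    have "card R = card (S \<times> (unit_cube :: (int ^ 'd) set)) - card (g ` (I \<times> unit_cube))"
      unfolding R_def using sub finI by (intro card_Diff_subset) auto
    moreover have "card (g ` (I \<times> unit_cube)) \<le> card (S \<times> (unit_cube :: (int ^ 'd) set))"
      using sub fin by (intro card_mono) auto
    ultimately show ?thesis using card_image[OF inj] by simp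
  qed
  finally show ?thesis by (simp add: card_cartesian_product card_unit_cube mult.commute)
qed

section \<open>Lattice animals\<close>

fun trace :: "'a::ab_group_add \<Rightarrow> 'a list \<Rightarrow> 'a set" where
  "trace x [] = {x}"
| "trace x (s # ss) = insert x (trace (x + s) ss)"

definition steps :: "(int ^ 'd) set" where
  "steps = {s. \<forall>i. s $ i \<in> {-1, 0, 1}}"

text \<open>A finite connected set of \<open>m\<close> points is the set of points visited by a walk of \<open>2 * (m - 1)\<close>
  steps, which goes around a spanning tree. This is what connectedness means here; it is the
  form in which connected sets are easily counted.\<close>

definition animal :: "int ^ 'd \<Rightarrow> (int ^ 'd) set \<Rightarrow> bool" where
  "animal x S \<longleftrightarrow> (\<exists>ss. set ss \<subseteq> steps \<and> length ss = 2 * (card S - 1) \<and> S = trace x ss)"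

lemma finite_trace [simp]: "finite (trace x ss)"
  by (induction ss arbitrary: x) auto

lemma steps_near: "near u v \<longleftrightarrow> v - u \<in> steps"
  unfolding near_def steps_def
proof (simp, intro iff_allI)
  fix i show "\<bar>u $ i - v $ i\<bar> \<le> 1 \<longleftrightarrow> v $ i - u $ i = -1 \<or> v $ i = u $ i \<or> v $ i - u $ i = 1"
    by linarith
qed

lemma uminus_steps: "s \<in> steps \<Longrightarrow> - s \<in> steps"
  by (force simp: steps_def)

lemma finite_steps [simp]: "finite (steps :: (int ^ 'd::finite) set)"
  and card_steps: "card (steps :: (int ^ 'd::finite) set) = 3 ^ CARD('d)"
  using finite_vec_power[of "{-1, 0, 1 :: int}", where ?'d = 'd]
    card_vec_power[of "{-1, 0, 1 :: int}", where ?'d = 'd]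
  by (simp_all add: steps_def numeral_3_eq_3)

text \<open>At the first visit to \<open>u\<close> the walk steps aside by \<open>s\<close> and returns.\<close>

lemma trace_detour:
  assumes "u \<in> trace x ss" "set ss \<subseteq> steps" "s \<in> steps"
  shows "\<exists>ss'. set ss' \<subseteq> steps \<and> length ss' = length ss + 2 \<and>
    trace x ss' = insert (u + s) (trace x ss)"
  using assms
proof (induction ss arbitrary: x)
  case Nil
  then show ?case by (intro exI[of _ "[s, - s]"]) (auto simp: uminus_steps)
next
  case (Cons t ss)
  show ?case
  proof (cases "u = x")
    case True
    then show ?thesis
      using Cons.prems by (intro exI[of _ "s # - s # t # ss"]) (auto simp: uminus_steps)
  next
    case False
    then have "u \<in> trace (x + t) ss" using Cons.prems by simp
    from Cons.IH[OF this] Cons.prems obtain ss' where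
      "set ss' \<subseteq> steps" "length ss' = length ss + 2"
      "trace (x + t) ss' = insert (u + s) (trace (x + t) ss)" by auto
    then show ?thesis using Cons.prems by (intro exI[of _ "t # ss'"]) auto
  qed
qed

lemma animal_finite: "animal x S \<Longrightarrow> finite S"
  by (auto simp: animal_def)

lemma animal_singleton: "animal x {x}"
  by (auto simp: animal_def intro!: exI[of _ "[]"])

lemma animal_insert:
  assumes "animal x S" "u \<in> S" "near u v"
  shows "animal x (insert v S)"
proof (cases "v \<in> S")
  case True
  then show ?thesis using assms by (simp add: insert_absorb)
next
  case False
  obtain ss where ss: "set ss \<subseteq> steps" "length ss = 2 * (card S - 1)" "S = trace x ss"
    using assms(1) by (auto simp: animal_def)
  have "card S > 0" using assms animal_finite by (auto simp: card_gt_0_iff)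
  then have "card (insert v S) - 1 = Suc (card S - 1)"
    using False animal_finite[OF assms(1)] by simp
  moreover obtain ss' where "set ss' \<subseteq> steps" "length ss' = length ss + 2"
    "trace x ss' = insert (u + (v - u)) (trace x ss)"
    using trace_detour[of u x ss "v - u"] ss assms steps_near by auto
  ultimately show ?thesis unfolding animal_def using ss by (intro exI[of _ ss']) auto
qed

text \<open>Close points lie in the same block or in adjacent ones, so adding to \<open>S\<close> points close to it
  keeps the set of blocks connected.\<close>

lemma animal_block_grow:
  assumes "animal x (block L ` S)" "finite T" "S \<subseteq> T" "0 < L" "\<And>v. v \<in> T \<Longrightarrow> \<exists>u\<in>S. near u v"
  shows "animal x (block L ` T)"
proof -
  have "animal x (block L ` (S \<union> R))" if "R \<subseteq> T" for R
    using finite_subset[OF that assms(2)] that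
  proof (induction R rule: finite_induct)
    case empty
    then show ?case using assms by simp
  next
    case (insert v R)
    then obtain u where u: "u \<in> S" "near u v" using assms(5) by auto
    have "animal x (insert (block L v) (block L ` (S \<union> R)))"
      using insert u assms(4) near_block[of u v L] by (intro animal_insert[of _ _ "block L u"]) auto
    then show ?case by simp
  qed
  from this[of T] show ?thesis using assms(3) by (simp add: Un_absorb1)
qed

lemma finite_card_animals:
  fixes x :: "int ^ 'd::finite"
  shows "finite {S. animal x S \<and> card S = m}"
    and "card {S. animal x S \<and> card S = m} \<le> (9 ^ CARD('d)) ^ m"
proof -
  define W where "W = {ss :: (int ^ 'd) list. set ss \<subseteq> steps \<and> length ss = 2 * (m - 1)}"
  have W: "finite W" "card W = (3 ^ CARD('d)) ^ (2 * (m - 1))"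
    unfolding W_def by (simp_all add: finite_lists_length_eq card_lists_length_eq card_steps)
  have sub: "{S. animal x S \<and> card S = m} \<subseteq> trace x ` W"
    by (auto simp: animal_def W_def)
  then show "finite {S. animal x S \<and> card S = m}" using W finite_subset by blast
  have "card {S. animal x S \<and> card S = m} \<le> card W"
    using sub W(1) by (rule surj_card_le[rotated])
  also have "card W = ((3 ^ CARD('d)) ^ 2) ^ (m - 1)" unfolding W(2) by (rule power_mult)
  also have "((3 :: nat) ^ CARD('d)) ^ 2 = 9 ^ CARD('d)"
    by (simp add: power2_eq_square flip: power_mult_distrib)
  also have "((9 :: nat) ^ CARD('d)) ^ (m - 1) \<le> (9 ^ CARD('d)) ^ m"
    by (intro power_increasing) auto
  finally show "card {S. animal x S \<and> card S = m} \<le> (9 ^ CARD('d)) ^ m" .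
qed

section \<open>The body-centered lattice in integer coordinates\<close>

definition even_pt :: "int ^ 'd \<Rightarrow> int ^ 'd" where
  "even_pt a = (\<chi> i. 2 * a $ i)"

definition odd_pt :: "int ^ 'd \<Rightarrow> int ^ 'd" where
  "odd_pt b = (\<chi> i. 2 * b $ i + 1)"

lemma inj_even_pt: "inj even_pt" and inj_odd_pt: "inj odd_pt"
  by (auto simp: inj_on_def even_pt_def odd_pt_def vec_eq_iff)

lemma even_pt_eq_iff [simp]: "even_pt a = even_pt b \<longleftrightarrow> a = b"
  and odd_pt_eq_iff [simp]: "odd_pt a = odd_pt b \<longleftrightarrow> a = b"
  using inj_even_pt inj_odd_pt by (auto dest: injD)

lemma even_vertex_even_pt [simp]: "even_vertex (even_pt a)"
  and odd_vertex_odd_pt [simp]: "odd_vertex (odd_pt b)"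
  by (auto simp: even_vertex_def odd_vertex_def even_pt_def odd_pt_def)

lemma not_odd_if_even: "even_vertex v \<Longrightarrow> \<not> odd_vertex v"
  by (auto simp: even_vertex_def odd_vertex_def)

lemma even_vertex_iff: "even_vertex v \<longleftrightarrow> v \<in> range even_pt"
proof
  assume "even_vertex v"
  then have "v = even_pt (\<chi> i. v $ i div 2)" by (simp add: even_pt_def even_vertex_def vec_eq_iff)
  then show "v \<in> range even_pt" by blast
qed auto

lemma odd_vertex_iff: "odd_vertex v \<longleftrightarrow> v \<in> range odd_pt"
proof
  assume "odd_vertex v"
  then have "v = odd_pt (\<chi> i. v $ i div 2)" by (simp add: odd_pt_def odd_vertex_def vec_eq_iff)
  then show "v \<in> range odd_pt" by blast
qed auto

lemma not_even_vertex_odd_pt [simp]: "\<not> even_vertex (odd_pt b)"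
  and not_odd_vertex_even_pt [simp]: "\<not> odd_vertex (even_pt a)"
  using not_odd_if_even even_vertex_even_pt odd_vertex_odd_pt by blast+

lemma even_pt_neq_odd_pt [simp]: "even_pt a \<noteq> odd_pt b" "odd_pt b \<noteq> even_pt a"
  by (metis even_vertex_even_pt not_even_vertex_odd_pt)+

lemma bcc_adj_sym: "bcc_adj u v \<Longrightarrow> bcc_adj v u"
  by (auto simp: bcc_adj_def abs_minus_commute)

text \<open>The odd vertex \<open>odd_pt b\<close> is the centre of the cube whose corners are the even vertices
  \<open>even_pt (b + c)\<close>, and these are its neighbours.\<close>

lemma bcc_adj_even_pt_odd_pt:
  fixes a b :: "int ^ 'd::finite"
  shows "bcc_adj (even_pt a) (odd_pt b) \<longleftrightarrow> a - b \<in> unit_cube"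
proof -
  have coord: "\<bar>2 * x - (2 * y + 1)\<bar> \<le> 1 \<longleftrightarrow> x - y \<in> {0, 1}" for x y :: int by auto
  have ge: "1 \<le> \<bar>2 * x - (2 * y + 1)\<bar>" for x y :: int by presburger
  have "Max (range (\<lambda>i. \<bar>even_pt a $ i - odd_pt b $ i\<bar>)) = 1
      \<longleftrightarrow> (\<forall>i. \<bar>even_pt a $ i - odd_pt b $ i\<bar> \<le> 1)"
  proof
    assume m: "Max (range (\<lambda>i. \<bar>even_pt a $ i - odd_pt b $ i\<bar>)) = 1"
    show "\<forall>i. \<bar>even_pt a $ i - odd_pt b $ i\<bar> \<le> 1"
      unfolding m[symmetric] by (intro allI Max_ge) auto
  next
    assume le: "\<forall>i. \<bar>even_pt a $ i - odd_pt b $ i\<bar> \<le> 1"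
    have "\<bar>even_pt a $ i - odd_pt b $ i\<bar> = 1" for i
      using le ge[of "a $ i" "b $ i"] by (simp add: even_pt_def odd_pt_def order_antisym)
    then show "Max (range (\<lambda>i. \<bar>even_pt a $ i - odd_pt b $ i\<bar>)) = 1" by simp
  qed
  also have "\<dots> \<longleftrightarrow> a - b \<in> unit_cube"
    unfolding even_pt_def odd_pt_def unit_cube_def using coord by simp
  finally show ?thesis by (simp add: bcc_adj_def)
qed

lemma bcc_adj_parity: "bcc_adj u v \<Longrightarrow> even_vertex u \<longleftrightarrow> \<not> even_vertex v"
  by (auto simp: bcc_adj_def dest: not_odd_if_even)

lemma bcc_adj_from_even_pt:
  fixes a :: "int ^ 'd::finite"
  assumes "bcc_adj (even_pt a) v"
  obtains b c where "v = odd_pt b" "c \<in> unit_cube" "a = b + c"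
proof -
  have "odd_vertex v" using assms by (auto simp: bcc_adj_def)
  then obtain b where "v = odd_pt b" by (auto simp: odd_vertex_iff)
  then show thesis using that[of b "a - b"] assms bcc_adj_even_pt_odd_pt by auto
qed

lemma bcc_adj_from_odd_pt:
  fixes b :: "int ^ 'd::finite"
  assumes "bcc_adj (odd_pt b) v"
  obtains c where "c \<in> unit_cube" "v = even_pt (b + c)"
proof -
  have "even_vertex v" using assms by (auto simp: bcc_adj_def)
  then obtain a where "v = even_pt a" by (auto simp: even_vertex_iff)
  then show thesis using that[of "a - b"] bcc_adj_sym[OF assms] bcc_adj_even_pt_odd_pt by auto
qed

lemma finite_nbrs_open_bcc:
  fixes F :: "(int ^ 'd::finite) set"
  assumes "finite F"
  shows "finite (nbrs (open_adj bcc_adj C) F)"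
proof -
  have "nbrs (open_adj bcc_adj C) F \<subseteq> (\<Union>u\<in>F. {v. \<forall>i. v $ i \<in> {u $ i - 1..u $ i + 1}})"
  proof
    fix v assume "v \<in> nbrs (open_adj bcc_adj C) F"
    then obtain u where u: "u \<in> F" "bcc_adj u v" by (auto simp: nbrs_def open_adj_def)
    then have m: "Max (range (\<lambda>i. \<bar>u $ i - v $ i\<bar>)) = 1" by (simp add: bcc_adj_def)
    have "\<bar>u $ i - v $ i\<bar> \<le> 1" for i
      unfolding m[symmetric] by (intro Max_ge) auto
    then have "v $ i \<in> {u $ i - 1..u $ i + 1}" for i by (simp add: abs_le_iff) (smt (verit))
    then show "v \<in> (\<Union>u\<in>F. {v. \<forall>i. v $ i \<in> {u $ i - 1..u $ i + 1}})" using u by blast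
  qed
  moreover have "finite \<dots>" using assms by (intro finite_UN_I finite_card_vec_box) auto
  ultimately show ?thesis by (rule finite_subset)
qed

section \<open>Clusters outside the set of maximal deficiency\<close>

definition lattice_box :: "int ^ 'd \<Rightarrow> nat \<Rightarrow> (int ^ 'd) set" where
  "lattice_box x n = {a. \<forall>i. \<bar>a $ i - x $ i\<bar> \<le> int n}"

lemma finite_lattice_box [simp]: "finite (lattice_box (x :: int ^ 'd::finite) n)"
  and card_lattice_box: "card (lattice_box (x :: int ^ 'd::finite) n) = (2 * n + 1) ^ CARD('d)"
proof -
  have "\<bar>a $ i - x $ i\<bar> \<le> int n \<longleftrightarrow> a $ i \<in> {x $ i - int n..x $ i + int n}" for a i by auto
  then have *: "lattice_box x n = {a. \<forall>i. a $ i \<in> {x $ i - int n..x $ i + int n}}"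
    by (simp add: lattice_box_def)
  show "finite (lattice_box x n)" "card (lattice_box x n) = (2 * n + 1) ^ CARD('d)"
    unfolding * using finite_card_vec_box[of "\<lambda>i. {x $ i - int n..x $ i + int n}"]
    by (simp_all add: nat_add_distrib nat_mult_distrib)
qed

lemma near_lattice_box: "a \<in> lattice_box x n \<Longrightarrow> near a b \<Longrightarrow> b \<in> lattice_box x (Suc n)"
  unfolding lattice_box_def near_def
proof (safe)
  fix i assume "\<forall>i. \<bar>a $ i - x $ i\<bar> \<le> int n" "\<forall>i. \<bar>a $ i - b $ i\<bar> \<le> 1"
  from spec[OF this(1), of i] spec[OF this(2), of i] show "\<bar>b $ i - x $ i\<bar> \<le> int (Suc n)" by simp
qed

lemma lattice_box_mono: "m \<le> n \<Longrightarrow> lattice_box x m \<subseteq> lattice_box x n"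
  by (auto simp: lattice_box_def intro: order_trans[of _ "int m"])

fun cluster_ball :: "(int ^ 'd) set \<Rightarrow> int ^ 'd \<Rightarrow> nat \<Rightarrow> (int ^ 'd) set" where
  "cluster_ball B x 0 = {x}"
| "cluster_ball B x (Suc r) = {a \<in> B. \<exists>a'\<in>cluster_ball B x r. near a' a}"

lemmas [simp del] = cluster_ball.simps(2)
lemmas cluster_ball_Suc = cluster_ball.simps(2)

lemma cluster_ball_subset: "x \<in> B \<Longrightarrow> cluster_ball B x r \<subseteq> B"
  by (cases r) (auto simp: cluster_ball_Suc)

lemma cluster_ball_mono_Suc: "x \<in> B \<Longrightarrow> cluster_ball B x r \<subseteq> cluster_ball B x (Suc r)"
  unfolding cluster_ball_Suc using cluster_ball_subset[of x B r] near_refl by blast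

lemma center_in_cluster_ball: "x \<in> B \<Longrightarrow> x \<in> cluster_ball B x r"
proof (induction r)
  case (Suc r)
  then show ?case using cluster_ball_mono_Suc[of x B r] by blast
qed simp

lemma cluster_ball_subset_lattice_box: "cluster_ball B x r \<subseteq> lattice_box x r"
proof (induction r)
  case 0
  then show ?case by (simp add: lattice_box_def)
next
  case (Suc r)
  then show ?case using near_lattice_box[of _ x r] by (auto simp: cluster_ball_Suc)
qed

lemma finite_cluster_ball [simp]: "finite (cluster_ball B (x :: int ^ 'd::finite) r)"
  by (rule finite_subset[OF cluster_ball_subset_lattice_box finite_lattice_box])

lemma animal_block_cluster_ball:
  fixes x :: "int ^ 'd::finite"
  assumes "0 < L" "x \<in> B"
  shows "animal (block L x) (block L ` cluster_ball B x r)"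
proof (induction r)
  case 0
  then show ?case by (simp add: animal_singleton)
next
  case (Suc r)
  show ?case
    by (rule animal_block_grow[OF Suc.IH finite_cluster_ball cluster_ball_mono_Suc assms(1)])
      (use assms in \<open>auto simp: cluster_ball_Suc\<close>)
qed

locale bcc_box =
  max_deficiency "open_adj bcc_adj C" "even_pt ` lattice_box x n - C" "{v. even_vertex v}" A
  for C :: "(int ^ 'd::finite) set" and x :: "int ^ 'd" and n :: nat and A :: "(int ^ 'd) set"
begin

text \<open>The even vertices of the box outside \<open>A\<close>. Closed ones are included, so that an odd vertex from
  which \<open>A\<close> cannot be reached in one move has a full cube of such vertices around it.\<close>

definition losing :: "(int ^ 'd) set" where
  "losing = {a \<in> lattice_box x n. even_pt a \<notin> A}"

abbreviation ball :: "nat \<Rightarrow> (int ^ 'd) set" where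
  "ball r \<equiv> cluster_ball losing x r"

definition stops :: bool where
  "stops \<longleftrightarrow> (\<exists>r<n. ball (Suc r) = ball r)"

lemma A_open: "v \<in> A \<Longrightarrow> v \<notin> C"
  using A_\<Lambda> by auto

text \<open>The cluster is closed under passing from an even vertex over an open odd vertex outside the
  neighbourhood of \<open>A\<close> to another even vertex. The assumption \<open>r < n\<close> ensures that the cluster has
  not yet reached the boundary of the box, beyond which nothing is known.\<close>

lemma losing_near_ball:
  assumes "a \<in> ball r" "r < n" "a = b + c" "c \<in> unit_cube" "c' \<in> unit_cube"
    and "odd_pt b \<notin> C" "odd_pt b \<notin> nbrs (open_adj bcc_adj C) A"
  shows "b + c' \<in> ball (Suc r)"
proof -
  have near: "near a (b + c')" using assms near_unit_cube by auto
  have "b + c' \<in> lattice_box x (Suc r)"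
    using assms(1) near cluster_ball_subset_lattice_box near_lattice_box by blast
  then have "b + c' \<in> lattice_box x n" using assms(2) lattice_box_mono[of "Suc r" n x] by auto
  moreover have "even_pt (b + c') \<notin> A"
  proof
    assume "even_pt (b + c') \<in> A"
    moreover have "bcc_adj (even_pt (b + c')) (odd_pt b)"
      using assms(5) by (simp add: bcc_adj_even_pt_odd_pt)
    ultimately show False using assms(6,7) A_open by (auto simp: nbrs_def open_adj_def)
  qed
  ultimately have "b + c' \<in> losing" by (simp add: losing_def)
  then show ?thesis unfolding cluster_ball_Suc using near assms(1) by blast
qed

text \<open>An outer neighbour of the open part of a ball either has all its neighbours in the ball or is
  itself a neighbour of the next sphere, whose points have \<open>2 ^ CARD('d)\<close> neighbours each.\<close>

lemma ball_surplus:
  assumes x: "x \<in> losing" and r: "r < n"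
  shows "card (ball r - even_pt -` C)
    \<le> card {b. odd_pt b \<notin> C \<and> (\<forall>c\<in>unit_cube. b + c \<in> ball r)}
      + 2 ^ CARD('d) * card (ball (Suc r) - ball r)"
proof -
  define I where "I = {b. odd_pt b \<notin> C \<and> (\<forall>c\<in>unit_cube. b + c \<in> ball r)}"
  \<comment> \<open>These are the cubes that have a corner in the next sphere.\<close>
  define J where "J = (\<lambda>(a, c). a - c) ` ((ball (Suc r) - ball r) \<times> (unit_cube :: (int ^ 'd) set))"
  define F where "F = even_pt ` (ball r - even_pt -` C)"
  have I_sub: "I \<subseteq> ball r"
  proof
    fix b assume "b \<in> I"
    then have "\<forall>c\<in>unit_cube. b + c \<in> ball r" by (simp add: I_def)
    from bspec[OF this zero_in_unit_cube] show "b \<in> ball r" by simp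
  qed
  then have finI: "finite I" by (rule finite_subset) simp
  have finJ: "finite J" by (simp add: J_def)
  have F: "F \<subseteq> (even_pt ` lattice_box x n - C) - A"
    using cluster_ball_subset[OF x, of r] by (auto simp: F_def losing_def)
  have "nbrs (open_adj bcc_adj C) F - nbrs (open_adj bcc_adj C) A \<subseteq> odd_pt ` (I \<union> J)"
  proof
    fix v assume v: "v \<in> nbrs (open_adj bcc_adj C) F - nbrs (open_adj bcc_adj C) A"
    then obtain a where a: "a \<in> ball r" "bcc_adj (even_pt a) v" "v \<notin> C"
      by (auto simp: nbrs_def F_def open_adj_def)
    then obtain b c where b: "v = odd_pt b" "c \<in> unit_cube" "a = b + c"
      by (elim bcc_adj_from_even_pt)
    have "b \<in> J" if "b \<notin> I"
    proof -
      obtain c' where c': "c' \<in> unit_cube" "b + c' \<notin> ball r" using \<open>b \<notin> I\<close> a b by (auto simp: I_def)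
      have "b + c' \<in> ball (Suc r)"
        using losing_near_ball[OF a(1) r b(3,2) c'(1)] v a b by blast
      then have "(b + c', c') \<in> (ball (Suc r) - ball r) \<times> unit_cube" using c' by simp
      then have "(\<lambda>(a, c). a - c) (b + c', c') \<in> J" unfolding J_def by (rule imageI)
      then show ?thesis by simp
    qed
    then show "v \<in> odd_pt ` (I \<union> J)" using b by blast
  qed
  then have "card (nbrs (open_adj bcc_adj C) F - nbrs (open_adj bcc_adj C) A) \<le> card (I \<union> J)"
    using finI finJ by (intro surj_card_le) auto
  also have "\<dots> \<le> card I + card J" by (rule card_Un_le)
  also have "card J \<le> card ((ball (Suc r) - ball r) \<times> (unit_cube :: (int ^ 'd) set))"
    unfolding J_def by (intro card_image_le) simp
  also have "\<dots> = 2 ^ CARD('d) * card (ball (Suc r) - ball r)"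
    by (simp add: card_cartesian_product card_unit_cube)
  finally have "card (nbrs (open_adj bcc_adj C) F - nbrs (open_adj bcc_adj C) A)
    \<le> card I + 2 ^ CARD('d) * card (ball (Suc r) - ball r)" by simp
  moreover have "card F \<le> card (nbrs (open_adj bcc_adj C) F - nbrs (open_adj bcc_adj C) A)"
    by (rule outer_surplus[OF F])
  moreover have "card F = card (ball r - even_pt -` C)"
    unfolding F_def by (rule card_image) (meson inj_even_pt inj_on_subset subset_UNIV)
  ultimately show ?thesis by (simp add: I_def)
qed

text \<open>A ball that equals the next one is a whole cluster, away from the boundary of the box.\<close>

lemma closed_region_ball:
  assumes x: "x \<in> losing" and r: "r < n" and stop: "ball (Suc r) = ball r"
  shows "closed_region (open_adj bcc_adj C) (even_pt ` lattice_box x n - C) {v. even_vertex v} A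
    (even_pt ` ball r - C)"
proof unfold_locales
  show "even_pt ` ball r - C \<subseteq> (even_pt ` lattice_box x n - C) - A"
    using cluster_ball_subset[OF x, of r] by (auto simp: losing_def)
next
  fix v
  assume v: "v \<in> nbrs (open_adj bcc_adj C) (even_pt ` ball r - C) - nbrs (open_adj bcc_adj C) A"
  then obtain a where a: "a \<in> ball r" "bcc_adj (even_pt a) v" "v \<notin> C"
    by (auto simp: nbrs_def open_adj_def)
  then obtain b c where b: "v = odd_pt b" "c \<in> unit_cube" "a = b + c"
      by (elim bcc_adj_from_even_pt)
  show "nbrs (open_adj bcc_adj C) {v} \<subseteq> even_pt ` ball r - C"
  proof
    fix u assume "u \<in> nbrs (open_adj bcc_adj C) {v}"
    then have u: "bcc_adj (odd_pt b) u" "u \<notin> C" by (auto simp: nbrs_def open_adj_def b)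
    then obtain c' where c': "c' \<in> unit_cube" "u = even_pt (b + c')" by (elim bcc_adj_from_odd_pt)
    have "b + c' \<in> ball (Suc r)"
      using losing_near_ball[OF a(1) r b(3,2) c'(1)] v a b by blast
    then show "u \<in> even_pt ` ball r - C" using stop u c' by auto
  qed
qed

lemma second_wins_if_not_losing: "x \<notin> losing \<Longrightarrow> trap_second_wins (open_adj bcc_adj C) (even_pt x)"
  by (intro second_wins_in_A) (auto simp: losing_def lattice_box_def)

lemma first_wins_if_not_losing:
  assumes "x \<notin> losing" "odd_pt x \<notin> C"
  shows "trap_first_wins (open_adj bcc_adj C) (odd_pt x)"
proof (rule first_wins_near_A)
  have "even_pt x \<in> A" using assms by (auto simp: losing_def lattice_box_def)
  moreover have "bcc_adj (even_pt x) (odd_pt x)" by (simp add: bcc_adj_even_pt_odd_pt)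
  ultimately show "odd_pt x \<in> nbrs (open_adj bcc_adj C) A"
    using assms A_open by (auto simp: nbrs_def open_adj_def)
qed

lemma first_wins_from_even:
  assumes "x \<in> losing" stops "even_pt x \<notin> C"
  shows "trap_first_wins (open_adj bcc_adj C) (even_pt x)"
proof -
  obtain r where r: "r < n" "ball (Suc r) = ball r" using assms by (auto simp: stops_def)
  interpret closed_region "open_adj bcc_adj C" "even_pt ` lattice_box x n - C" "{v. even_vertex v}" A
    "even_pt ` ball r - C" using assms(1) r by (rule closed_region_ball)
  show ?thesis using center_in_cluster_ball[OF assms(1)] assms(3) by (intro first_wins_in_K) auto
qed

lemma no_draw_from_odd:
  assumes "x \<in> losing" stops "odd_pt x \<notin> C"
  shows "trap_first_wins (open_adj bcc_adj C) (odd_pt x) \<or>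
    trap_second_wins (open_adj bcc_adj C) (odd_pt x)"
proof (cases "odd_pt x \<in> nbrs (open_adj bcc_adj C) A")
  case True
  then show ?thesis using first_wins_near_A by blast
next
  case False
  obtain r where r: "r < n" "ball (Suc r) = ball r" using assms by (auto simp: stops_def)
  interpret closed_region "open_adj bcc_adj C" "even_pt ` lattice_box x n - C" "{v. even_vertex v}" A
    "even_pt ` ball r - C" using assms(1) r by (rule closed_region_ball)
  show ?thesis
  proof (rule no_draw_near_K)
    show "nbrs (open_adj bcc_adj C) {odd_pt x} \<subseteq> even_pt ` ball r - C"
    proof
      fix u assume "u \<in> nbrs (open_adj bcc_adj C) {odd_pt x}"
      then have u: "bcc_adj (odd_pt x) u" "u \<notin> C" by (auto simp: nbrs_def open_adj_def)
      then obtain c where c: "c \<in> unit_cube" "u = even_pt (x + c)" by (elim bcc_adj_from_odd_pt)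
      have "x + c \<in> ball (Suc r)"
        by (rule losing_near_ball[OF center_in_cluster_ball[OF assms(1)] r(1) _ zero_in_unit_cube])
          (use c assms False in auto)
      then show "u \<in> even_pt ` ball r - C" using r(2) u c by auto
    qed
  qed simp
qed

text \<open>If all even vertices are open then a cluster that stops growing has more points than outer
  neighbours: the latter correspond to the points \<open>b\<close> such that the cube of corner \<open>b\<close> lies in the
  cluster, and a point of maximal coordinate sum is not among these.\<close>

lemma not_losing_if_stops:
  assumes stops and even: "\<And>a. even_pt a \<notin> C"
  shows "x \<notin> losing"
proof
  assume x: "x \<in> losing"
  obtain r where r: "r < n" "ball (Suc r) = ball r" using assms(1) by (auto simp: stops_def)
  define I where "I = {b. odd_pt b \<notin> C \<and> (\<forall>c\<in>unit_cube. b + c \<in> ball r)}"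
  have "even_pt -` C = {}" using even by auto
  then have le: "card (ball r) \<le> card I"
    using ball_surplus[OF x r(1)] r(2) by (simp add: I_def)
  define s where "s a = (\<Sum>i\<in>UNIV. a $ i)" for a :: "int ^ 'd"
  have ne: "ball r \<noteq> {}" using center_in_cluster_ball[OF x] by blast
  obtain a where a: "a \<in> ball r" "\<And>b. b \<in> ball r \<Longrightarrow> s b \<le> s a"
  proof -
    have "Max (s ` ball r) \<in> s ` ball r" using ne by (intro Max_in) auto
    then obtain a where "a \<in> ball r" "s a = Max (s ` ball r)" by auto
    then show thesis using that by (metis Max_ge finite_cluster_ball finite_imageI imageI)
  qed
  have "I \<subseteq> ball r - {a}"
  proof
    fix b assume "b \<in> I"
    then have all: "\<forall>c\<in>unit_cube. b + c \<in> ball r" by (simp add: I_def)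
    have "b + (\<chi> i. 1) \<in> ball r" by (rule bspec[OF all]) (simp add: unit_cube_def)
    then have "s (b + (\<chi> i. 1)) \<le> s a" by (rule a(2))
    then have "b \<noteq> a" by (auto simp: s_def sum.distrib)
    moreover have "b \<in> ball r" using bspec[OF all zero_in_unit_cube] by simp
    ultimately show "b \<in> ball r - {a}" by simp
  qed
  then have "card I \<le> card (ball r - {a})" by (intro card_mono) auto
  also have "\<dots> < card (ball r)" using a(1) by (intro card_Diff1_less) auto
  finally show False using le by simp
qed

end

lemma exists_bcc_box: "\<exists>A. bcc_box C (x :: int ^ 'd::finite) n A"
proof -
  let ?adj = "open_adj (bcc_adj :: int ^ 'd \<Rightarrow> _) C"
  have sym: "?adj u v \<Longrightarrow> ?adj v u" for u v by (auto simp: open_adj_def intro: bcc_adj_sym)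
  have fin: "finite (even_pt ` lattice_box x n - C)" by simp
  obtain A where A: "A \<subseteq> even_pt ` lattice_box x n - C"
    "\<And>F. F \<subseteq> even_pt ` lattice_box x n - C \<Longrightarrow>
      card F + card (nbrs ?adj A) \<le> card A + card (nbrs ?adj F)"
    "\<And>x. x \<in> A \<Longrightarrow> matched_into ?adj (nbrs ?adj A) (A - {x})"
    using exists_minimal_max_deficiency[OF fin finite_nbrs_open_bcc sym] by metis
  have "bcc_box C x n A"
    by unfold_locales
      (use A sym fin finite_nbrs_open_bcc in \<open>auto simp: open_adj_def dest: bcc_adj_parity\<close>)
  then show ?thesis ..
qed

lemma finite_card_block_vimage:
  fixes S :: "(int ^ 'd::finite) set"
  assumes "0 < L" "finite S"
  shows "finite (block L -` S)" "card (block L -` S) = nat L ^ CARD('d) * card S"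
proof -
  have *: "block L -` S = (\<Union>Q\<in>S. {a. block L a = Q})" by auto
  show "finite (block L -` S)" unfolding * using assms by (auto simp: finite_card_block)
  have "card (block L -` S) = (\<Sum>Q\<in>S. card {a. block L a = Q})"
    unfolding * using assms by (intro card_UN_disjoint) (auto simp: finite_card_block)
  then show "card (block L -` S) = nat L ^ CARD('d) * card S"
    using assms by (simp add: finite_card_block mult.commute)
qed

section \<open>Exponential growth of clusters\<close>

lemma exponential_beats_power:
  fixes a :: real
  assumes "1 < a"
  shows "\<exists>n. a ^ R * real ((2 * n + 1) ^ d) < a ^ n"
proof -
  have "((\<lambda>n. a ^ R * (2 * real n + 1) ^ d / a ^ n) \<longlongrightarrow> 0) sequentially"
    using assms by real_asymp
  then have "eventually (\<lambda>n. a ^ R * (2 * real n + 1) ^ d / a ^ n < 1) sequentially"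
    by (rule order_tendstoD) simp
  then obtain n where "a ^ R * (2 * real n + 1) ^ d / a ^ n < 1"
    using eventually_happens'[OF sequentially_bot] by blast
  then have "a ^ R * (2 * real n + 1) ^ d < a ^ n" using assms by (simp add: divide_less_eq)
  then show ?thesis by (intro exI[of _ n]) (simp add: add.commute)
qed

text \<open>The connected set \<open>S\<close> stands for the blocks met by a ball in a cluster. The first inequality
  makes the loss from \<open>block_isoperimetry\<close> exceed \<open>card S / 2\<close>; since a closed even vertex makes up
  for a loss of \<open>2 ^ CARD('d)\<close> in the scale of that lemma, the second inequality leaves at least
  \<open>card S / 4\<close> of it.\<close>

definition favourable :: "int \<Rightarrow> (int ^ 'd::finite) set \<Rightarrow> int ^ 'd \<Rightarrow> bool" where
  "favourable L C Q \<longleftrightarrow> (\<exists>N. \<forall>S. animal Q S \<and> N \<le> card S \<longrightarrow>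
      2 * card (S - block L ` (odd_pt -` C)) < card S \<and>
      4 * 2 ^ CARD('d) * card (block L -` S \<inter> even_pt -` C) < card S)"

text \<open>Comparing \<open>block_isoperimetry\<close> with \<open>ball_surplus\<close>: what the closed even vertices do not make
  up for is supplied by the next sphere, each point of which counts \<open>(2 ^ CARD('d))\<^sup>2\<close> times.\<close>

lemma (in bcc_box) ball_growth:
  assumes x: "x \<in> losing" and r: "r < n" and L: "0 < L"
    and S: "S = block L ` ball r"
    and odd: "2 * card (S - block L ` (odd_pt -` C)) < card S"
    and even: "4 * 2 ^ CARD('d) * card (block L -` S \<inter> even_pt -` C) < card S"
  shows "card (ball r) \<le> 4 * (2 ^ CARD('d))\<^sup>2 * nat L ^ CARD('d) * card (ball (Suc r) - ball r)"
proof -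
  define D :: nat where "D = 2 ^ CARD('d)"
  define I where "I = {b. odd_pt b \<notin> C \<and> (\<forall>c\<in>unit_cube. b + c \<in> ball r)}"
  define \<delta> where "\<delta> = card (ball (Suc r) - ball r)"
  define ce where "ce = card (block L -` S \<inter> even_pt -` C)"
  define W where "W = odd_pt -` C"
  have finS: "finite S" by (simp add: S)
  have 1: "card (S \<inter> block L ` W) + D * card I \<le> D * card (ball r)"
    using block_isoperimetry[OF L finite_cluster_ball, of losing x r W]
    by (simp add: I_def D_def S W_def)
  have 2: "card (ball r - even_pt -` C) \<le> card I + D * \<delta>"
    using ball_surplus[OF x r] by (simp add: I_def D_def \<delta>_def)
  have 3: "card (ball r) \<le> ce + card (ball r - even_pt -` C)"
  proof -
    have "card (ball r) \<le> card ((ball r \<inter> even_pt -` C) \<union> (ball r - even_pt -` C))"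
      by (intro card_mono) auto
    also have "\<dots> \<le> card (ball r \<inter> even_pt -` C) + card (ball r - even_pt -` C)" by (rule card_Un_le)
    also have "card (ball r \<inter> even_pt -` C) \<le> ce"
      unfolding ce_def S using finite_card_block_vimage(1)[OF L finS]
      by (intro card_mono) (auto simp: S)
    finally show ?thesis by simp
  qed
  have 4: "card S \<le> card (S \<inter> block L ` W) + card (S - block L ` W)"
    using card_Un_le[of "S \<inter> block L ` W" "S - block L ` W"] by (simp add: Int_Diff_Un)
  have "D * card (ball r) \<le> D * (ce + (card I + D * \<delta>))"
    using 2 3 by (intro mult_le_mono) auto
  then have "card (S \<inter> block L ` W) \<le> D * ce + D\<^sup>2 * \<delta>"
    using 1 by (simp add: algebra_simps power2_eq_square)
  moreover have "4 * (D * ce) < card S" using even by (simp add: D_def ce_def mult.assoc)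
  moreover have "2 * card (S - block L ` W) < card S" using odd by (simp add: W_def)
  ultimately have m: "card S \<le> 4 * (D\<^sup>2 * \<delta>)" using 4 by linarith
  have "card (ball r) \<le> card (block L -` S)"
    using finite_card_block_vimage(1)[OF L finS] by (intro card_mono) (auto simp: S)
  also have "\<dots> = nat L ^ CARD('d) * card S" by (rule finite_card_block_vimage(2)[OF L finS])
  also have "\<dots> \<le> nat L ^ CARD('d) * (4 * (D\<^sup>2 * \<delta>))" using m by (intro mult_le_mono) auto
  finally show ?thesis by (simp add: D_def \<delta>_def mult_ac)
qed

text \<open>A cluster that does not stop has more than \<open>r\<close> points in the ball of radius \<open>r\<close>, hence meets so
  many blocks that the favourable inequalities apply from some radius \<open>R\<close> on. From there on it grows
  exponentially, while it lies in a box whose size is a power of the radius.\<close>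

lemma favourable_cluster_stops:
  fixes x :: "int ^ 'd::finite"
  assumes L: "0 < L" and fav: "favourable L C (block L x)"
  shows "\<exists>n. \<forall>A. bcc_box C x n A \<longrightarrow> x \<in> bcc_box.losing x n A \<longrightarrow> bcc_box.stops x n A"
proof -
  obtain N where N: "\<And>S. animal (block L x) S \<Longrightarrow> N \<le> card S \<Longrightarrow>
      2 * card (S - block L ` (odd_pt -` C)) < card S \<and>
      4 * 2 ^ CARD('d) * card (block L -` S \<inter> even_pt -` C) < card S"
    using fav unfolding favourable_def by blast
  define V where "V = nat L ^ CARD('d)"
  define M where "M = 4 * (2 ^ CARD('d))\<^sup>2 * V"
  define R where "R = V * N"
  define a where "a = 1 + 1 / real M"
  have "V > 0" using L by (simp add: V_def)
  then have M: "M > 0" by (simp add: M_def)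
  then have a: "1 < a" by (simp add: a_def)
  obtain n where n: "a ^ R * real ((2 * n + 1) ^ CARD('d)) < a ^ n"
    using exponential_beats_power[OF a] by blast
  show ?thesis
  proof (rule exI[of _ n], intro allI impI)
    fix A assume "bcc_box C x n A" and x: "x \<in> bcc_box.losing x n A"
    then interpret bcc_box C x n A by simp
    show stops
    proof (rule ccontr)
      assume "\<not> stops"
      then have ne: "ball (Suc r) \<noteq> ball r" if "r < n" for r using that by (auto simp: stops_def)
      have size: "r < card (ball r)" if "r \<le> n" for r
        using that
      proof (induction r)
        case (Suc r)
        have "ball r \<subset> ball (Suc r)"
          using ne[of r] cluster_ball_mono_Suc[OF x, of r] Suc.prems by auto
        then have "card (ball r) < card (ball (Suc r))" by (intro psubset_card_mono) auto
        then show ?case using Suc by simp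
      qed simp
      have grow: "a * card (ball r) \<le> card (ball (Suc r))" if r: "R \<le> r" "r < n" for r
      proof -
        define S where "S = block L ` ball r"
        have an: "animal (block L x) S" unfolding S_def by (rule animal_block_cluster_ball[OF L x])
        have "V * N < card (ball r)" using size[of r] r by (simp add: R_def)
        also have "card (ball r) \<le> card (block L -` S)"
          using finite_card_block_vimage(1)[OF L, of S] by (intro card_mono) (auto simp: S_def)
        also have "\<dots> = V * card S"
          using finite_card_block_vimage(2)[OF L, of S] by (simp add: S_def V_def)
        finally have "N \<le> card S" by simp
        then have "card (ball r) \<le> M * card (ball (Suc r) - ball r)"
          unfolding M_def V_def using ball_growth[OF x r(2) L S_def] N[OF an] by blast
        also have "card (ball (Suc r) - ball r) = card (ball (Suc r)) - card (ball r)"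
          using cluster_ball_mono_Suc[OF x, of r] by (intro card_Diff_subset) auto
        finally have "real (card (ball r)) \<le> real (M * (card (ball (Suc r)) - card (ball r)))"
          by (rule of_nat_mono)
        also have "\<dots> = real M * (real (card (ball (Suc r))) - real (card (ball r)))"
          using card_mono[OF finite_cluster_ball cluster_ball_mono_Suc[OF x, of r]]
          by (simp add: of_nat_diff)
        finally show ?thesis using M by (simp add: a_def field_simps)
      qed
      have pow: "a ^ r \<le> a ^ R * card (ball r)" if "r \<le> n" for r
        using that
      proof (induction r)
        case 0
        then show ?case using a by simp
      next
        case (Suc r)
        show ?case
        proof (cases "R \<le> r")
          case True
          have "a ^ Suc r \<le> a * (a ^ R * card (ball r))"
            using Suc a by (simp add: mult_left_mono)
          also have "\<dots> = a ^ R * (a * card (ball r))" by simp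
          also have "\<dots> \<le> a ^ R * card (ball (Suc r))"
            using grow[OF True] Suc.prems a by (intro mult_left_mono) auto
          finally show ?thesis .
        next
          case False
          then have "a ^ Suc r \<le> a ^ R * 1" using a by (simp del: power_Suc)
          also have "\<dots> \<le> a ^ R * card (ball (Suc r))"
            using size[OF Suc.prems] a by (intro mult_left_mono) auto
          finally show ?thesis .
        qed
      qed
      have "card (ball n) \<le> card (lattice_box x n)"
        using cluster_ball_subset_lattice_box by (intro card_mono) auto
      then have "real (card (ball n)) \<le> real ((2 * n + 1) ^ CARD('d))"
        unfolding card_lattice_box by (rule of_nat_mono)
      then have "a ^ R * card (ball n) \<le> a ^ R * real ((2 * n + 1) ^ CARD('d))"
        using a by (intro mult_left_mono) auto
      then have "a ^ n \<le> a ^ R * real ((2 * n + 1) ^ CARD('d))" using pow[of n] by linarith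
      then show False using n by simp
    qed
  qed
qed

section \<open>Random configurations are favourable\<close>

lemma product_prob_space_bernoulli:
  "product_prob_space (\<lambda>v. measure_pmf (bernoulli_pmf (if odd_vertex v then p else q)))"
  by (intro product_prob_spaceI prob_space_measure_pmf)

lemma prob_space_bcc_config: "prob_space (bcc_config p q)"
  unfolding bcc_config_def by (intro prob_space_PiM prob_space_measure_pmf)

lemma
  assumes J: "finite J" "J \<subseteq> bcc_vertices"
  shows cylinder_measurable:
      "{\<omega> \<in> space (bcc_config p q). \<forall>v\<in>J. \<omega> v = \<beta>} \<in> sets (bcc_config p q)"
    and prob_cylinder: "measure (bcc_config p q) {\<omega> \<in> space (bcc_config p q). \<forall>v\<in>J. \<omega> v = \<beta>}
      = (\<Prod>v\<in>J. pmf (bernoulli_pmf (if odd_vertex v then p else q)) \<beta>)"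
proof -
  let ?M = "\<lambda>v :: int ^ 'a. measure_pmf (bernoulli_pmf (if odd_vertex v then p else q))"
  interpret P: product_prob_space ?M bcc_vertices by (rule product_prob_space_bernoulli)
  have eq: "{\<omega> \<in> space (bcc_config p q). \<forall>v\<in>J. \<omega> v = \<beta>} = P.emb bcc_vertices J (Pi\<^sub>E J (\<lambda>_. {\<beta>}))"
  proof -
    have "{\<omega> \<in> space (Pi\<^sub>M bcc_vertices ?M). \<forall>v\<in>J. \<omega> v \<in> X v}
        = P.emb bcc_vertices J (Pi\<^sub>E J X)" for X
      unfolding prod_emb_def using J by (auto simp: space_PiM Pi_iff)
    from this[of "\<lambda>_. {\<beta>}"] show ?thesis by (simp add: bcc_config_def)
  qed
  show "{\<omega> \<in> space (bcc_config p q). \<forall>v\<in>J. \<omega> v = \<beta>} \<in> sets (bcc_config p q)"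
    unfolding eq unfolding bcc_config_def using J by (intro sets_PiM_I) auto
  show "measure (bcc_config p q) {\<omega> \<in> space (bcc_config p q). \<forall>v\<in>J. \<omega> v = \<beta>}
      = (\<Prod>v\<in>J. pmf (bernoulli_pmf (if odd_vertex v then p else q)) \<beta>)"
    unfolding eq unfolding bcc_config_def using J
    by (subst P.measure_PiM_emb) (auto simp: measure_pmf_single)
qed

lemma even_pt_odd_pt_in_bcc_vertices [simp]: "even_pt a \<in> bcc_vertices" "odd_pt b \<in> bcc_vertices"
  by (simp_all add: bcc_vertices_def)

lemma prob_all_odd_open:
  assumes "finite B" "0 \<le> p" "p \<le> 1"
  shows "measure (bcc_config p q) {\<omega> \<in> space (bcc_config p q). \<forall>v\<in>odd_pt ` B. \<omega> v = False}
    = (1 - p) ^ card B"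
proof -
  have "inj_on odd_pt B" using inj_odd_pt inj_on_subset by blast
  then show ?thesis
    using assms by (subst prob_cylinder) (auto simp: prod.reindex)
qed

lemma prob_all_even_closed:
  assumes "finite T" "0 \<le> q" "q \<le> 1"
  shows "measure (bcc_config p q) {\<omega> \<in> space (bcc_config p q). \<forall>v\<in>even_pt ` T. \<omega> v = True}
    = q ^ card T"
proof -
  have "inj_on even_pt T" using inj_even_pt inj_on_subset by blast
  then show ?thesis
    using assms by (subst prob_cylinder) (auto simp: prod.reindex)
qed

text \<open>The union bound against at most \<open>c ^ m\<close> events of probability at most \<open>\<eta> ^ m\<close>, followed by
  the Borel-Cantelli lemma.\<close>

lemma (in prob_space) AE_eventually_avoid:
  fixes J :: "nat \<Rightarrow> 'j set" and E :: "'j \<Rightarrow> 'a set" and c :: nat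
  assumes J: "\<And>m. finite (J m)" "\<And>m. card (J m) \<le> c ^ m"
    and E: "\<And>m j. j \<in> J m \<Longrightarrow> E j \<in> events" "\<And>m j. j \<in> J m \<Longrightarrow> prob (E j) \<le> \<eta> ^ m"
    and \<eta>: "0 \<le> \<eta>" "real c * \<eta> \<le> 1 / 2"
  shows "AE \<omega> in M. \<exists>N. \<forall>m\<ge>N. \<forall>j\<in>J m. \<omega> \<notin> E j"
proof -
  define A where "A m = (\<Union>j\<in>J m. E j)" for m
  have A: "A m \<in> events" for m unfolding A_def using J E by (intro sets.finite_UN) auto
  have "prob (A m) \<le> (1 / 2) ^ m" for m
  proof -
    have "prob (A m) \<le> (\<Sum>j\<in>J m. prob (E j))"
      unfolding A_def using J E by (intro finite_measure_subadditive_finite) auto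
    also have "\<dots> \<le> real (card (J m)) * \<eta> ^ m" using E by (intro sum_bounded_above) auto
    also have "\<dots> \<le> real (c ^ m) * \<eta> ^ m"
      using J \<eta> by (intro mult_right_mono of_nat_mono) auto
    also have "\<dots> = (real c * \<eta>) ^ m" by (simp add: power_mult_distrib)
    also have "\<dots> \<le> (1 / 2) ^ m" using \<eta> by (intro power_mono) auto
    finally show ?thesis .
  qed
  then have "summable (\<lambda>m. prob (A m))"
    by (intro summable_comparison_test'[OF summable_geometric[of "1 / 2 :: real"], of 0]) auto
  then have "AE \<omega> in M. eventually (\<lambda>m. \<omega> \<in> space M - A m) sequentially"
    using A by (intro borel_cantelli_AE1) (auto simp: emeasure_eq_measure)
  then show ?thesis
  proof eventually_elim
    case (elim \<omega>)
    then obtain N where "\<forall>m\<ge>N. \<omega> \<notin> A m" unfolding eventually_sequentially by blast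
    then show ?case by (intro exI[of _ N]) (simp add: A_def)
  qed
qed

text \<open>If the claim fails for \<open>S\<close> then all odd vertices are open in at least half of the blocks of \<open>S\<close>.
  There are at most \<open>9 ^ (CARD('d) * m)\<close> animals \<open>S\<close> of size \<open>m\<close> and \<open>2 ^ m\<close> ways to choose these
  blocks; the assumption on the size of the blocks beats both.\<close>

lemma AE_few_blocks_without_closed_odd:
  fixes Q :: "int ^ 'd::finite"
  assumes p: "0 \<le> p" "p \<le> 1" and L: "0 < L"
    and small: "(1 - p) ^ (nat L ^ CARD('d)) \<le> (1 / (4 * 9 ^ CARD('d)))\<^sup>2"
  shows "AE \<omega> in bcc_config p q. \<exists>N. \<forall>S. animal Q S \<and> N \<le> card S \<longrightarrow>
    2 * card (S - block L ` {b. \<omega> (odd_pt b)}) < card S"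
proof -
  interpret prob_space "bcc_config p q :: (int ^ 'd \<Rightarrow> bool) measure" by (rule prob_space_bcc_config)
  let ?M = "bcc_config p q :: (int ^ 'd \<Rightarrow> bool) measure"
  define \<eta> :: real where "\<eta> = 1 / (4 * 9 ^ CARD('d))"
  define V where "V = nat L ^ CARD('d)"
  define J where "J m = (\<Union>S\<in>{S. animal Q S \<and> card S = m}. {T. T \<subseteq> S \<and> m \<le> 2 * card T})" for m
  define E where "E T = {\<omega> \<in> space ?M. \<forall>v\<in>odd_pt ` (block L -` T). \<omega> v = False}" for T
  have "(1 :: real) \<le> 4 * 9 ^ CARD('d)"
    using mult_mono[of 1 4 1 "9 ^ CARD('d) :: real"] by simp
  then have \<eta>: "0 \<le> \<eta>" "\<eta> \<le> 1" by (simp_all add: \<eta>_def divide_le_eq)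
  have "AE \<omega> in ?M. \<exists>N. \<forall>m\<ge>N. \<forall>T\<in>J m. \<omega> \<notin> E T"
  proof (rule AE_eventually_avoid[where c = "9 ^ CARD('d) * 2" and \<eta> = \<eta>])
    fix m
    have sub: "J m \<subseteq> (\<Union>S\<in>{S. animal Q S \<and> card S = m}. Pow S)" by (auto simp: J_def)
    have fin: "finite (\<Union>S\<in>{S. animal Q S \<and> card S = m}. Pow S)"
      using finite_card_animals(1)[of Q m] animal_finite by auto
    show "finite (J m)" using sub fin by (rule finite_subset)
    have "card (J m) \<le> card (\<Union>S\<in>{S. animal Q S \<and> card S = m}. Pow S)"
      using sub fin by (intro card_mono)
    also have "\<dots> \<le> (\<Sum>S\<in>{S. animal Q S \<and> card S = m}. card (Pow S))"
      using finite_card_animals(1)[of Q m] by (rule card_UN_le)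
    also have "\<dots> = (\<Sum>S\<in>{S. animal Q S \<and> card S = m}. 2 ^ m)"
      by (intro sum.cong) (auto simp: card_Pow animal_finite)
    also have "\<dots> \<le> (9 ^ CARD('d)) ^ m * 2 ^ m"
      using finite_card_animals(2)[of Q m] by simp
    also have "\<dots> = (9 ^ CARD('d) * 2) ^ m" by (simp only: power_mult_distrib)
    finally show "card (J m) \<le> (9 ^ CARD('d) * 2) ^ m" .
    fix T assume "T \<in> J m"
    then obtain S where S: "animal Q S" "T \<subseteq> S" and m: "m \<le> 2 * card T" by (auto simp: J_def)
    have finT: "finite T" using S animal_finite finite_subset by blast
    note fin' = finite_card_block_vimage[OF L finT]
    show "E T \<in> events" unfolding E_def using fin'(1) by (intro cylinder_measurable) auto
    have "prob (E T) = (1 - p) ^ (V * card T)"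
      unfolding E_def prob_all_odd_open[OF fin'(1) p] fin'(2) by (simp add: V_def)
    also have "\<dots> = ((1 - p) ^ V) ^ card T" by (rule power_mult)
    also have "\<dots> \<le> (\<eta>\<^sup>2) ^ card T"
      using small p by (intro power_mono) (auto simp: \<eta>_def V_def)
    also have "\<dots> = \<eta> ^ (2 * card T)" by (rule power_mult[symmetric])
    also have "\<dots> \<le> \<eta> ^ m" using m \<eta> by (intro power_decreasing) auto
    finally show "prob (E T) \<le> \<eta> ^ m" .
  qed (simp_all add: \<eta>_def)
  then show ?thesis using AE_space
  proof eventually_elim
    case (elim \<omega>)
    then obtain N where N: "\<And>m T. N \<le> m \<Longrightarrow> T \<in> J m \<Longrightarrow> \<omega> \<notin> E T" by blast
    have "2 * card (S - block L ` {b. \<omega> (odd_pt b)}) < card S"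
      if S: "animal Q S" "N \<le> card S" for S
    proof (rule ccontr)
      assume "\<not> ?thesis"
      then have "S - block L ` {b. \<omega> (odd_pt b)} \<in> J (card S)" using S by (auto simp: J_def)
      from N[OF S(2) this] show False using elim(2) by (auto simp: E_def)
    qed
    then show ?case by blast
  qed
qed

text \<open>If the claim fails for an animal \<open>S\<close> of size \<open>m\<close> then at least \<open>m / k\<close> even vertices in the
  blocks of \<open>S\<close> are closed. They form one of at most \<open>2 ^ (V * m)\<close> sets, where \<open>V\<close> is the number of
  even vertices in a block; the bound on \<open>q\<close> beats this number and the number of animals.\<close>

lemma AE_few_closed_even:
  fixes Q :: "int ^ 'd::finite"
  assumes q: "0 \<le> q" "q \<le> 1" and L: "0 < L"
    and small: "q \<le> (1 / (2 * (9 ^ CARD('d) * 2 ^ (nat L ^ CARD('d))))) ^ k"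
  shows "AE \<omega> in bcc_config p q. \<exists>N. \<forall>S. animal Q S \<and> N \<le> card S \<longrightarrow>
    k * card (block L -` S \<inter> {a. \<omega> (even_pt a)}) < card S"
proof -
  interpret prob_space "bcc_config p q :: (int ^ 'd \<Rightarrow> bool) measure" by (rule prob_space_bcc_config)
  let ?M = "bcc_config p q :: (int ^ 'd \<Rightarrow> bool) measure"
  define V where "V = nat L ^ CARD('d)"
  define \<eta> :: real where "\<eta> = 1 / (2 * (9 ^ CARD('d) * 2 ^ V))"
  define J where
    "J m = (\<Union>S\<in>{S. animal Q S \<and> card S = m}. {T. T \<subseteq> block L -` S \<and> m \<le> k * card T})" for m
  define E where "E T = {\<omega> \<in> space ?M. \<forall>v\<in>even_pt ` T. \<omega> v = True}" for T
  have "(1 :: real) \<le> 2 * (9 ^ CARD('d) * 2 ^ V)"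
    using mult_mono[of 1 "9 ^ CARD('d)" 1 "2 ^ V :: real"] by simp
  then have \<eta>: "0 \<le> \<eta>" "\<eta> \<le> 1" by (simp_all add: \<eta>_def divide_le_eq)
  have "AE \<omega> in ?M. \<exists>N. \<forall>m\<ge>N. \<forall>T\<in>J m. \<omega> \<notin> E T"
  proof (rule AE_eventually_avoid[where c = "9 ^ CARD('d) * 2 ^ V" and \<eta> = \<eta>])
    fix m
    have sub: "J m \<subseteq> (\<Union>S\<in>{S. animal Q S \<and> card S = m}. Pow (block L -` S))" by (auto simp: J_def)
    have fin: "finite (\<Union>S\<in>{S. animal Q S \<and> card S = m}. Pow (block L -` S))"
      using finite_card_animals(1)[of Q m] animal_finite finite_card_block_vimage(1)[OF L] by auto
    show "finite (J m)" using sub fin by (rule finite_subset)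
    have "card (J m) \<le> card (\<Union>S\<in>{S. animal Q S \<and> card S = m}. Pow (block L -` S))"
      using sub fin by (intro card_mono)
    also have "\<dots> \<le> (\<Sum>S\<in>{S. animal Q S \<and> card S = m}. card (Pow (block L -` S)))"
      using finite_card_animals(1)[of Q m] by (rule card_UN_le)
    also have "\<dots> = (\<Sum>S\<in>{S. animal Q S \<and> card S = m}. 2 ^ (V * m))"
      by (intro sum.cong)
        (auto simp: card_Pow animal_finite finite_card_block_vimage[OF L] V_def)
    also have "\<dots> \<le> (9 ^ CARD('d)) ^ m * (2 ^ V) ^ m"
      using finite_card_animals(2)[of Q m] by (simp add: power_mult)
    also have "\<dots> = (9 ^ CARD('d) * 2 ^ V) ^ m" by (simp only: power_mult_distrib)
    finally show "card (J m) \<le> (9 ^ CARD('d) * 2 ^ V) ^ m" .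
    fix T assume "T \<in> J m"
    then obtain S where S: "animal Q S" "T \<subseteq> block L -` S" and m: "m \<le> k * card T"
      by (auto simp: J_def)
    have finT: "finite T"
      using finite_subset[OF S(2) finite_card_block_vimage(1)[OF L animal_finite[OF S(1)]]] .
    show "E T \<in> events" unfolding E_def using finT by (intro cylinder_measurable) auto
    have "prob (E T) = q ^ card T" unfolding E_def by (rule prob_all_even_closed[OF finT q])
    also have "\<dots> \<le> (\<eta> ^ k) ^ card T"
      using small q by (intro power_mono) (auto simp: \<eta>_def V_def)
    also have "\<dots> = \<eta> ^ (k * card T)" by (rule power_mult[symmetric])
    also have "\<dots> \<le> \<eta> ^ m" using m \<eta> by (intro power_decreasing) auto
    finally show "prob (E T) \<le> \<eta> ^ m" .
  qed (simp_all add: \<eta>_def)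
  then show ?thesis using AE_space
  proof eventually_elim
    case (elim \<omega>)
    then obtain N where N: "\<And>m T. N \<le> m \<Longrightarrow> T \<in> J m \<Longrightarrow> \<omega> \<notin> E T" by blast
    have "k * card (block L -` S \<inter> {a. \<omega> (even_pt a)}) < card S"
      if S: "animal Q S" "N \<le> card S" for S
    proof (rule ccontr)
      assume "\<not> ?thesis"
      then have "block L -` S \<inter> {a. \<omega> (even_pt a)} \<in> J (card S)" using S by (auto simp: J_def)
      from N[OF S(2) this] show False using elim(2) by (auto simp: E_def)
    qed
    then show ?case by blast
  qed
qed

text \<open>The size of the blocks is chosen first, according to \<open>p\<close>, and then the bound on \<open>q\<close>.\<close>

lemma AE_favourable:
  assumes p: "0 < p" "p \<le> 1"
  obtains L q0 where "0 < L" "0 < q0"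
    "\<And>q. 0 \<le> q \<Longrightarrow> q \<le> 1 \<Longrightarrow> q < q0 \<Longrightarrow>
      AE \<omega> in (bcc_config p q :: (int ^ 'd::finite \<Rightarrow> bool) measure).
        \<forall>Q. favourable L (closed_vertices \<omega>) Q"
proof -
  define \<epsilon> :: real where "\<epsilon> = (1 / (4 * 9 ^ CARD('d)))\<^sup>2"
  obtain l where l: "(1 - p) ^ l < \<epsilon>"
    using real_arch_pow_inv[of \<epsilon> "1 - p"] p by (auto simp: \<epsilon>_def)
  define L where "L = int (Suc l)"
  define k :: nat where "k = 4 * 2 ^ CARD('d)"
  define q0 :: real where "q0 = (1 / (2 * (9 ^ CARD('d) * 2 ^ (nat L ^ CARD('d))))) ^ k"
  have "nat L = Suc l" unfolding L_def by (rule nat_int)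
  then have "l \<le> nat L ^ CARD('d)" using self_le_power[of "Suc l" "CARD('d)"] by simp
  then have "(1 - p) ^ (nat L ^ CARD('d)) \<le> (1 - p) ^ l" using p by (intro power_decreasing) auto
  then have small: "(1 - p) ^ (nat L ^ CARD('d)) \<le> \<epsilon>" using l by simp
  have L: "0 < L" by (simp add: L_def)
  show thesis
  proof
    show "0 < L" by (rule L)
    show "0 < q0" by (simp add: q0_def)
    fix q :: real assume q: "0 \<le> q" "q \<le> 1" "q < q0"
    have "AE \<omega> in (bcc_config p q :: (int ^ 'd \<Rightarrow> bool) measure). favourable L (closed_vertices \<omega>) Q"
      for Q
    proof -
      have "AE \<omega> in bcc_config p q. \<exists>N. \<forall>S. animal Q S \<and> N \<le> card S \<longrightarrow>
          2 * card (S - block L ` {b. \<omega> (odd_pt b)}) < card S"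
        using p L small by (intro AE_few_blocks_without_closed_odd) (auto simp: \<epsilon>_def)
      moreover have "AE \<omega> in bcc_config p q. \<exists>N. \<forall>S. animal Q S \<and> N \<le> card S \<longrightarrow>
          k * card (block L -` S \<inter> {a. \<omega> (even_pt a)}) < card S"
        using q L by (intro AE_few_closed_even) (auto simp: q0_def)
      ultimately show ?thesis
      proof eventually_elim
        case (elim \<omega>)
        then obtain N1 N2 where
          "\<forall>S. animal Q S \<and> N1 \<le> card S \<longrightarrow> 2 * card (S - block L ` {b. \<omega> (odd_pt b)}) < card S"
          "\<forall>S. animal Q S \<and> N2 \<le> card S \<longrightarrow> k * card (block L -` S \<inter> {a. \<omega> (even_pt a)}) < card S"
          by blast
        moreover have "odd_pt -` closed_vertices \<omega> = {b. \<omega> (odd_pt b)}"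
          "even_pt -` closed_vertices \<omega> = {a. \<omega> (even_pt a)}"
          by (auto simp: closed_vertices_def)
        ultimately show ?case
          unfolding favourable_def by (intro exI[of _ "max N1 N2"]) (simp add: k_def)
      qed
    qed
    then show "AE \<omega> in (bcc_config p q :: (int ^ 'd \<Rightarrow> bool) measure).
        \<forall>Q. favourable L (closed_vertices \<omega>) Q"
      by (simp add: AE_all_countable)
  qed
qed

lemma AE_no_closed_even:
  "AE \<omega> in bcc_config p 0. \<forall>a :: int ^ 'd::finite. even_pt a \<notin> closed_vertices \<omega>"
proof -
  have "AE \<omega> in bcc_config p 0. \<not> \<omega> (even_pt a)" for a :: "int ^ 'd"
  proof -
    let ?M = "\<lambda>v :: int ^ 'd. measure_pmf (bernoulli_pmf (if odd_vertex v then p else 0))"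
    interpret P: product_prob_space ?M bcc_vertices by (rule product_prob_space_bernoulli)
    have "AE b in ?M (even_pt a). \<not> b" by (auto simp: AE_measure_pmf_iff set_pmf_iff)
    then show ?thesis unfolding bcc_config_def by (intro P.AE_component) auto
  qed
  then have "AE \<omega> in bcc_config p 0. \<forall>a :: int ^ 'd. \<not> \<omega> (even_pt a)"
    by (simp add: AE_all_countable)
  then show ?thesis by eventually_elim (simp add: closed_vertices_def)
qed

section \<open>The winner of the game\<close>

lemma bcc_vertices_cases:
  assumes "v \<in> bcc_vertices"
  obtains x where "v = even_pt x" | x where "v = odd_pt x"
  using assms by (auto simp: bcc_vertices_def even_vertex_iff odd_vertex_iff)

lemma bcc_draw_iff:
  "bcc_draw C v \<longleftrightarrow> \<not> open_trap_first_wins bcc_adj C v \<and> \<not> open_trap_second_wins bcc_adj C v"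
  by (cases "first_mover v") (auto simp: bcc_draw_def bcc_wins_def)

lemma no_draw_if_favourable:
  fixes v :: "int ^ 'd::finite"
  assumes L: "0 < L" and fav: "\<And>Q. favourable L C Q" and v: "v \<in> bcc_vertices"
  shows "\<not> bcc_draw C v"
proof (cases "v \<in> C")
  case True
  then show ?thesis by (simp add: bcc_draw_iff open_trap_first_wins_def)
next
  case False
  have win: "trap_first_wins (open_adj bcc_adj C) v \<or> trap_second_wins (open_adj bcc_adj C) v"
    using v
  proof (cases rule: bcc_vertices_cases)
    case (1 x)
    obtain n where n: "\<forall>A. bcc_box C x n A \<longrightarrow> x \<in> bcc_box.losing x n A \<longrightarrow>
        bcc_box.stops x n A"
      using favourable_cluster_stops[OF L fav] by blast
    obtain A where "bcc_box C x n A" using exists_bcc_box by blast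
    then interpret bcc_box C x n A .
    show ?thesis
      using n \<open>bcc_box C x n A\<close> second_wins_if_not_losing first_wins_from_even 1 False by blast
  next
    case (2 x)
    obtain n where n: "\<forall>A. bcc_box C x n A \<longrightarrow> x \<in> bcc_box.losing x n A \<longrightarrow>
        bcc_box.stops x n A"
      using favourable_cluster_stops[OF L fav] by blast
    obtain A where "bcc_box C x n A" using exists_bcc_box by blast
    then interpret bcc_box C x n A .
    show ?thesis
      using n \<open>bcc_box C x n A\<close> first_wins_if_not_losing no_draw_from_odd 2 False by blast
  qed
  then show ?thesis
    using False by (auto simp: bcc_draw_iff open_trap_first_wins_def open_trap_second_wins_def)
qed

lemma Eve_wins_if_favourable:
  fixes v :: "int ^ 'd::finite"
  assumes L: "0 < L" and fav: "\<And>Q. favourable L C Q" and even: "\<And>a. even_pt a \<notin> C"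
    and v: "v \<in> bcc_vertices"
  shows "bcc_wins C Eve v"
proof -
  have wins: "trap_second_wins (open_adj bcc_adj C) (even_pt x) \<and>
      (odd_pt x \<notin> C \<longrightarrow> trap_first_wins (open_adj bcc_adj C) (odd_pt x))" for x
  proof -
    obtain n where n: "\<forall>A. bcc_box C x n A \<longrightarrow> x \<in> bcc_box.losing x n A \<longrightarrow>
        bcc_box.stops x n A"
      using favourable_cluster_stops[OF L fav] by blast
    obtain A where A: "bcc_box C x n A" using exists_bcc_box by blast
    then interpret bcc_box C x n A .
    have "x \<notin> losing" using n A not_losing_if_stops even by blast
    then show ?thesis using second_wins_if_not_losing first_wins_if_not_losing by blast
  qed
  from v show ?thesis
  proof (cases rule: bcc_vertices_cases)
    case (1 x)
    then show ?thesis
      using wins[of x] even by (simp add: bcc_wins_def first_mover_def open_trap_second_wins_def)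
  next
    case (2 x)
    then show ?thesis
      using wins[of x] by (auto simp: bcc_wins_def first_mover_def open_trap_first_wins_def)
  qed
qed

theorem theorem1:
  assumes "CARD('d::finite) \<ge> 2"
  shows "(\<forall>p. 0 < p \<and> p \<le> 1 \<longrightarrow>
            (AE \<omega> in (bcc_config p 0 :: (int ^ 'd \<Rightarrow> bool) measure).
               \<forall>x\<in>bcc_vertices. bcc_wins (closed_vertices \<omega>) Eve x)) \<and>
         (\<forall>p. 0 < p \<and> p \<le> 1 \<longrightarrow>
            (\<exists>q\<^sub>0>0. \<forall>q. 0 \<le> q \<and> q \<le> 1 \<and> q < q\<^sub>0 \<longrightarrow>
               (AE \<omega> in (bcc_config p q :: (int ^ 'd \<Rightarrow> bool) measure).
                  \<forall>x\<in>bcc_vertices. \<not> bcc_draw (closed_vertices \<omega>) x)))"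
proof (intro conjI allI impI)
  fix p :: real assume p: "0 < p \<and> p \<le> 1"
  obtain L q0 where L: "0 < L" "0 < q0"
    and fav: "\<And>q. 0 \<le> q \<Longrightarrow> q \<le> 1 \<Longrightarrow> q < q0 \<Longrightarrow>
      AE \<omega> in (bcc_config p q :: (int ^ 'd \<Rightarrow> bool) measure). \<forall>Q. favourable L (closed_vertices \<omega>) Q"
    using AE_favourable[of p, where ?'d = 'd] p by blast
  have "AE \<omega> in (bcc_config p 0 :: (int ^ 'd \<Rightarrow> bool) measure).
      \<forall>Q. favourable L (closed_vertices \<omega>) Q"
    using L by (intro fav) auto
  then show "AE \<omega> in (bcc_config p 0 :: (int ^ 'd \<Rightarrow> bool) measure).
      \<forall>x\<in>bcc_vertices. bcc_wins (closed_vertices \<omega>) Eve x"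
    using AE_no_closed_even
    by eventually_elim (use L Eve_wins_if_favourable in blast)
next
  fix p :: real assume p: "0 < p \<and> p \<le> 1"
  obtain L q0 where L: "0 < L" "0 < q0"
    and fav: "\<And>q. 0 \<le> q \<Longrightarrow> q \<le> 1 \<Longrightarrow> q < q0 \<Longrightarrow>
      AE \<omega> in (bcc_config p q :: (int ^ 'd \<Rightarrow> bool) measure). \<forall>Q. favourable L (closed_vertices \<omega>) Q"
    using AE_favourable[of p, where ?'d = 'd] p by blast
  have "AE \<omega> in (bcc_config p q :: (int ^ 'd \<Rightarrow> bool) measure).
      \<forall>x\<in>bcc_vertices. \<not> bcc_draw (closed_vertices \<omega>) x" if "0 \<le> q \<and> q \<le> 1 \<and> q < q0" for q
    using fav[of q] that no_draw_if_favourable[OF L(1)] by (auto elim!: eventually_mono)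
  then show "\<exists>q\<^sub>0>0. \<forall>q. 0 \<le> q \<and> q \<le> 1 \<and> q < q\<^sub>0 \<longrightarrow>
      (AE \<omega> in (bcc_config p q :: (int ^ 'd \<Rightarrow> bool) measure).
        \<forall>x\<in>bcc_vertices. \<not> bcc_draw (closed_vertices \<omega>) x)"
    using L by blast
qed

end
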